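(* Let $\beta>0$ and $\ell>0$ be real numbers and let $\Omega=(0,\ell)\times(0,1)$, with points $(x,z)$. Let $I$ be the set of triples $(i,m,n)$ with $i\in\{1,-1\}$, $m\in\{0,1,2,\dots\}$, $n\in\{1,2,\dots\}$ and $(i,m)\neq(-1,0)$. For $(i,m,n)\in I$ let $\psi^{imn}(x,z)=\phi^{im}(x)\,\chi^n(z)\,e^{-\frac{\beta}{2}z}$, with $\phi^{im}$ and $\chi^n$ as defined in the context. Then the set of all the eigenfunctions $\psi^{imn}\in W^{2,2}_0(\Omega)$, $(i,m,n)\in I$, of the vorticity operator (operator and space as defined in the context), $$\Delta\psi^{imn}+\beta\,\partial_z\psi^{imn}=\mu_{mn}\,\psi^{imn},\qquad \mu_{mn}=-\left(\frac{\beta^2}{4}+\frac{4m^2\pi^2}{\ell^2}+n^2\pi^2\right),$$ is a complete basis for $L^2(\Omega)$. In particular, it is part of the assertion that each $\psi^{imn}$ belongs to $W^{2,2}_0(\Omega)$ and is an eigenfunction of the vorticity operator with eigenvalue $\mu_{mn}$. Moreover, the eigenfunctions are orthonormal with respect to the inner product $\langle f,g\rangle_\beta:=\int_\Omega f\,e^{\beta z}\,g\,d\Omega$, that is, for all $(i,m,n),(j,k,l)\in I$, $$\langle\psi^{imn},\psi^{jkl}\rangle_\beta=\int_\Omega\psi^{imn}\,e^{\beta z}\,\psi^{jkl}\,d\Omega=\delta_{ij}\,\delta_{mk}\,\delta_{nl}.$$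
   Context: All functions are real valued. For $m\ge 1$: $\phi^{1m}(x)=\sqrt{\tfrac{2}{\ell}}\cos\left(\tfrac{2\pi m}{\ell}x\right)$ and $\phi^{-1m}(x)=\sqrt{\tfrac{2}{\ell}}\sin\left(\tfrac{2\pi m}{\ell}x\right)$. For $m=0$ the normalization constant $\sqrt{2/\ell}$ is replaced by $\sqrt{1/\ell}$, so $\phi^{1\,0}(x)=\sqrt{1/\ell}$. For $n\ge1$: $\chi^n(z)=\sqrt2\,\sin(n\pi z)$ on $(0,1)$. Let $\mathcal C^\infty(\Omega)$ be the set of the restrictions to $\Omega$ of $C_0^\infty$-functions whose support is anywhere in the strip between $z=0$ and $z=1$. For $r\in\{0,1,2,\dots\}$, $W^{r,2}_0(\Omega)$ denotes the closure of $\mathcal C^\infty(\Omega)$ in the usual norm $\|\cdot\|_{r,2,\Omega}$ of the Sobolev space $W^{r,2}(\Omega)$ (for $r=0$ one gets $L^2(\Omega)$). The vorticity operator is $\psi\mapsto\Delta\psi+\beta\,\partial_z\psi$ with domain $W^{2,2}_0(\Omega)$, where $\Delta=\partial_x^2+\partial_z^2$. "Complete basis for $L^2(\Omega)$" means that every $f\in L^2(\Omega)$ can be uniquely expanded as $f=\sum_{(i,m,n)\in I}A^{imn}\psi^{imn}$, with real coefficients $A^{imn}$ and convergence in $L^2(\Omega)$.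
   Formalization: The C_0^∞-functions defining W^{r,2}_0 are replaced by functions smooth up to the boundary of the closed strip, compactly supported in it and vanishing at z=0 and z=1; with the literal definition normal derivatives would vanish there too and no ψ^{imn} would lie in W^{2,2}_0. *)

theory Defs
  imports "HOL-Analysis.Analysis"
begin

text \<open>Points of the plane are pairs \<open>(x, z)\<close>. Elements of \<open>L\<^sup>2\<close> and of the Sobolev spaces are
  represented by functions on the plane of which only the values on \<open>\<Omega>\<close> matter; equality of classes
  is equality almost everywhere on \<open>\<Omega>\<close>.\<close>

definition L2 :: "(real \<times> real) set \<Rightarrow> (real \<times> real \<Rightarrow> real) set" where
  "L2 \<Omega> = {f. f \<in> borel_measurable (lebesgue_on \<Omega>) \<and> integrable (lebesgue_on \<Omega>) (\<lambda>p. (f p)\<^sup>2)}"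

definition L2_norm :: "(real \<times> real) set \<Rightarrow> (real \<times> real \<Rightarrow> real) \<Rightarrow> real" where
  "L2_norm \<Omega> f = sqrt (LINT p|lebesgue_on \<Omega>. (f p)\<^sup>2)"

primrec C_k :: "nat \<Rightarrow> (real \<times> real \<Rightarrow> real) \<Rightarrow> bool" where
  "C_k 0 f \<longleftrightarrow> continuous_on UNIV f"
| "C_k (Suc k) f \<longleftrightarrow> (\<exists>fx fz. (\<forall>p. (f has_derivative (\<lambda>h. fx p * fst h + fz p * snd h)) (at p))
      \<and> C_k k fx \<and> C_k k fz)"

definition smooth :: "(real \<times> real \<Rightarrow> real) \<Rightarrow> bool" where
  "smooth f \<longleftrightarrow> (\<forall>k. C_k k f)"

definition supp :: "(real \<times> real \<Rightarrow> real) \<Rightarrow> (real \<times> real) set" where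
  "supp f = closure {p. f p \<noteq> 0}"

definition partial_x :: "(real \<times> real \<Rightarrow> real) \<Rightarrow> real \<times> real \<Rightarrow> real" where
  "partial_x f = (\<lambda>(x, z). deriv (\<lambda>t. f (t, z)) x)"

definition partial_z :: "(real \<times> real \<Rightarrow> real) \<Rightarrow> real \<times> real \<Rightarrow> real" where
  "partial_z f = (\<lambda>(x, z). deriv (\<lambda>t. f (x, t)) z)"

definition test_fun :: "(real \<times> real) set \<Rightarrow> (real \<times> real \<Rightarrow> real) set" where
  "test_fun \<Omega> = {\<theta>. smooth \<theta> \<and> compact (supp \<theta>) \<and> supp \<theta> \<subseteq> \<Omega>}"

definition is_weak_deriv ::
  "(real \<times> real) set \<Rightarrow> nat \<Rightarrow> nat \<Rightarrow> (real \<times> real \<Rightarrow> real) \<Rightarrow> (real \<times> real \<Rightarrow> real) \<Rightarrow> bool" where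
  "is_weak_deriv \<Omega> a b f g \<longleftrightarrow>
    (\<forall>\<theta>\<in>test_fun \<Omega>.
      (LINT p|lebesgue_on \<Omega>. f p * (partial_x ^^ a) ((partial_z ^^ b) \<theta>) p)
        = (-1) ^ (a + b) * (LINT p|lebesgue_on \<Omega>. g p * \<theta> p))"

text \<open>A representative of the weak derivative of order \<open>a\<close> in \<open>x\<close> and \<open>b\<close> in \<open>z\<close>. It is meaningful
  if such a derivative exists in \<open>L\<^sup>2\<close>, and is then determined almost everywhere on \<open>\<Omega>\<close>.\<close>

definition weak_deriv ::
  "(real \<times> real) set \<Rightarrow> nat \<Rightarrow> nat \<Rightarrow> (real \<times> real \<Rightarrow> real) \<Rightarrow> real \<times> real \<Rightarrow> real" where
  "weak_deriv \<Omega> a b f = (SOME g. g \<in> L2 \<Omega> \<and> is_weak_deriv \<Omega> a b f g)"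

definition sobolev :: "nat \<Rightarrow> (real \<times> real) set \<Rightarrow> (real \<times> real \<Rightarrow> real) set" where
  "sobolev r \<Omega> = {f \<in> L2 \<Omega>. \<forall>a b. a + b \<le> r \<longrightarrow> (\<exists>g\<in>L2 \<Omega>. is_weak_deriv \<Omega> a b f g)}"

definition sobolev_norm :: "nat \<Rightarrow> (real \<times> real) set \<Rightarrow> (real \<times> real \<Rightarrow> real) \<Rightarrow> real" where
  "sobolev_norm r \<Omega> f =
    sqrt (\<Sum>(a, b)\<in>{(a, b). a + b \<le> r}. (L2_norm \<Omega> (weak_deriv \<Omega> a b f))\<^sup>2)"

definition Omega :: "real \<Rightarrow> (real \<times> real) set" where
  "Omega l = {0<..<l} \<times> {0<..<1}"

definition strip :: "(real \<times> real) set" where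
  "strip = UNIV \<times> {0..1}"

text \<open>Smooth functions with compact support anywhere in the closed strip. Smoothness is required up
  to the boundary of the strip. Across \<open>z = 0\<close> and \<open>z = 1\<close> the function, which vanishes outside the
  strip, is only required to be continuous, so that it vanishes on these lines while its derivatives
  need not. Requiring smoothness across these lines (or a support in the open strip) would make the
  normal derivative vanish there too; the closure in \<open>W\<^sup>2\<^sup>,\<^sup>2\<close> would then consist of functions with zero
  normal derivative and would not contain the functions \<open>psi\<close> below. The closures in
  \<open>L\<^sup>2\<close> and \<open>W\<^sup>1\<^sup>,\<^sup>2\<close> are the same in both cases.\<close>

definition C0_inf_strip :: "(real \<times> real \<Rightarrow> real) set" where
  "C0_inf_strip = {f. continuous_on UNIV f \<and> (\<exists>g. smooth g \<and> (\<forall>p\<in>strip. f p = g p))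
      \<and> compact (supp f) \<and> supp f \<subseteq> strip}"

definition C_inf_Omega :: "real \<Rightarrow> (real \<times> real \<Rightarrow> real) set" where
  "C_inf_Omega l = {u. \<exists>v\<in>C0_inf_strip. \<forall>p\<in>Omega l. u p = v p}"

definition sobolev0 :: "nat \<Rightarrow> real \<Rightarrow> (real \<times> real \<Rightarrow> real) set" where
  "sobolev0 r l = {f \<in> sobolev r (Omega l).
      \<forall>e>0. \<exists>u\<in>C_inf_Omega l. sobolev_norm r (Omega l) (\<lambda>p. u p - f p) < e}"

definition vorticity_op :: "real \<Rightarrow> real \<Rightarrow> (real \<times> real \<Rightarrow> real) \<Rightarrow> real \<times> real \<Rightarrow> real" where
  "vorticity_op \<beta> l f p = weak_deriv (Omega l) 2 0 f p + weak_deriv (Omega l) 0 2 f p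
      + \<beta> * weak_deriv (Omega l) 0 1 f p"

definition vorticity_eigenfunction :: "real \<Rightarrow> real \<Rightarrow> real \<Rightarrow> (real \<times> real \<Rightarrow> real) \<Rightarrow> bool" where
  "vorticity_eigenfunction \<beta> l \<mu> f \<longleftrightarrow>
    f \<in> sobolev0 2 l \<and> \<not> (AE p in lebesgue_on (Omega l). f p = 0) \<and>
    (AE p in lebesgue_on (Omega l). vorticity_op \<beta> l f p = \<mu> * f p)"

definition index_set :: "(int \<times> nat \<times> nat) set" where
  "index_set = {(i, m, n). i \<in> {1, -1} \<and> n \<ge> 1 \<and> (i, m) \<noteq> (-1, 0)}"

definition phi :: "real \<Rightarrow> int \<Rightarrow> nat \<Rightarrow> real \<Rightarrow> real" where
  "phi l i m x = (if m = 0 then sqrt (1 / l) else sqrt (2 / l)) *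
      (if i = 1 then cos (2 * pi * real m / l * x) else sin (2 * pi * real m / l * x))"

definition chi :: "nat \<Rightarrow> real \<Rightarrow> real" where
  "chi n z = sqrt 2 * sin (real n * pi * z)"

definition psi :: "real \<Rightarrow> real \<Rightarrow> int \<times> nat \<times> nat \<Rightarrow> real \<times> real \<Rightarrow> real" where
  "psi \<beta> l = (\<lambda>(i, m, n) (x, z). phi l i m x * chi n z * exp (- (\<beta> / 2) * z))"

definition mu :: "real \<Rightarrow> real \<Rightarrow> nat \<Rightarrow> nat \<Rightarrow> real" where
  "mu \<beta> l m n = - (\<beta>\<^sup>2 / 4 + 4 * (real m)\<^sup>2 * pi\<^sup>2 / l\<^sup>2 + (real n)\<^sup>2 * pi\<^sup>2)"

text \<open>The index set carries no order, so the sum over it is the limit along the net of its finite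
  subsets, as for \<open>has_sum\<close>.\<close>

definition L2_has_sum :: "(real \<times> real) set \<Rightarrow> ('i \<Rightarrow> real \<times> real \<Rightarrow> real) \<Rightarrow>
    (real \<times> real \<Rightarrow> real) \<Rightarrow> 'i set \<Rightarrow> bool" where
  "L2_has_sum \<Omega> g f I \<longleftrightarrow>
    ((\<lambda>F. L2_norm \<Omega> (\<lambda>p. f p - (\<Sum>t\<in>F. g t p))) \<longlongrightarrow> 0) (finite_subsets_at_top I)"

definition complete_basis :: "(real \<times> real) set \<Rightarrow> ('i \<Rightarrow> real \<times> real \<Rightarrow> real) \<Rightarrow> 'i set \<Rightarrow> bool" where
  "complete_basis \<Omega> e I \<longleftrightarrow> (\<forall>t\<in>I. e t \<in> L2 \<Omega>) \<and>
    (\<forall>f\<in>L2 \<Omega>. \<exists>!A. A \<in> (I \<rightarrow>\<^sub>E UNIV) \<and> L2_has_sum \<Omega> (\<lambda>t p. A t * e t p) f I)"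

definition weighted_inner ::
  "real \<Rightarrow> real \<Rightarrow> (real \<times> real \<Rightarrow> real) \<Rightarrow> (real \<times> real \<Rightarrow> real) \<Rightarrow> real" where
  "weighted_inner \<beta> l f g = (LINT p|lebesgue_on (Omega l). f p * exp (\<beta> * snd p) * g p)"

end

theory Submission
  imports Defs
begin

text \<open>The factor \<open>exp (- \<beta> z / 2)\<close> is the whole difference between the eigenfunctions \<open>psi\<close> and the
  products \<open>trig_basis\<close> of the Fourier basis on \<open>(0, l)\<close> with the sine basis on \<open>(0, 1)\<close>. It turns the
  weighted inner product into the ordinary one (\<open>psi_weighted_product\<close>), it is bounded above and
  below on the rectangle, and it removes the first-order term of the vorticity operator
  (\<open>psi_vorticity\<close>). The theorem therefore rests on four facts.

  Orthonormality of \<open>trig_basis\<close> follows from iterated integrals and product-to-sum formulas.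

  The linear span of \<open>trig_basis\<close> is dense in \<open>L\<^sup>2\<close> (\<open>trig_span_dense\<close>). A bounded measurable function
  is an almost everywhere limit of bounded continuous functions; after division by (a regularised)
  \<open>sin (\<pi> z)\<close> these are approximated uniformly by polynomials in \<open>cos (2 \<pi> x / l)\<close>, \<open>sin (2 \<pi> x / l)\<close> and
  \<open>cos (\<pi> z)\<close>, by the Weierstrass theorem, and \<open>sin (\<pi> z)\<close> times such a polynomial lies in the span.
  Together with the best approximation property of Fourier sums this gives the expansion of
  every \<open>f\<close>, and continuity of the inner product gives uniqueness of the coefficients.

  Weak derivatives in \<open>L\<^sup>2\<close> are unique almost everywhere (\<open>weak_deriv_AE_eq\<close>), so for the smooth
  functions \<open>psi\<close> they are the classical derivatives, by integration by parts. Uniqueness needs the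
  density of test functions, which follows from that of the trigonometric span: its elements are smooth, and
  cutoffs make their support compact.

  Finally, \<open>psi\<close> belongs to \<open>W\<^sup>2\<^sup>,\<^sup>2\<^sub>0\<close> because it is itself the restriction of a function admitted in
  the definition of that space (\<open>psi_C_inf_Omega\<close>): it vanishes on \<open>z = 0\<close> and \<open>z = 1\<close>, and it can be cut off
  in \<open>x\<close> outside \<open>[0, l]\<close>.\<close>

section \<open>Smooth functions of two variables\<close>

lemma C_k_SucI:
  assumes "\<And>p. (f has_derivative (\<lambda>h. fx p * fst h + fz p * snd h)) (at p)" "C_k k fx" "C_k k fz"
  shows "C_k (Suc k) f"
  using assms by auto

lemma C_k_SucE:
  assumes "C_k (Suc k) f"
  obtains fx fz where "\<And>p. (f has_derivative (\<lambda>h. fx p * fst h + fz p * snd h)) (at p)"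
    "C_k k fx" "C_k k fz"
  using assms by auto

lemma C_k_Suc_imp_C_k: "C_k (Suc k) f \<Longrightarrow> C_k k f"
proof (induction k arbitrary: f)
  case 0
  obtain fx fz where "\<And>p. (f has_derivative (\<lambda>h. fx p * fst h + fz p * snd h)) (at p)"
    using C_k_SucE[OF 0] by blast
  then have "isCont f p" for p
    using has_derivative_continuous by blast
  then show ?case
    by (simp add: continuous_at_imp_continuous_on)
next
  case (Suc k)
  from Suc.prems obtain fx fz where
    "\<And>p. (f has_derivative (\<lambda>h. fx p * fst h + fz p * snd h)) (at p)"
    "C_k (Suc k) fx" "C_k (Suc k) fz" by (rule C_k_SucE) blast
  then show ?case
    by (intro C_k_SucI[of f fx fz] Suc.IH)
qed

lemma C_k_const: "C_k k (\<lambda>p. c)"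
proof (induction k arbitrary: c)
  case (Suc k)
  show ?case
    by (rule C_k_SucI[of _ "\<lambda>_. 0" "\<lambda>_. 0"]) (use Suc.IH in auto)
qed simp

lemma C_k_fst: "C_k k fst"
proof (cases k)
  case (Suc n)
  show ?thesis unfolding Suc
    by (rule C_k_SucI[of _ "\<lambda>_. 1" "\<lambda>_. 0"]) (auto intro: C_k_const has_derivative_fst has_derivative_ident)
qed (auto intro!: continuous_intros)

lemma C_k_snd: "C_k k snd"
proof (cases k)
  case (Suc n)
  show ?thesis unfolding Suc
    by (rule C_k_SucI[of _ "\<lambda>_. 0" "\<lambda>_. 1"]) (auto intro: C_k_const has_derivative_snd has_derivative_ident)
qed (auto intro!: continuous_intros)

lemma C_k_add: "C_k k f \<Longrightarrow> C_k k g \<Longrightarrow> C_k k (\<lambda>p. f p + g p)"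
proof (induction k arbitrary: f g)
  case (Suc k)
  obtain fx fz where f: "\<And>p. (f has_derivative (\<lambda>h. fx p * fst h + fz p * snd h)) (at p)"
    "C_k k fx" "C_k k fz" using Suc.prems(1) by (rule C_k_SucE) blast
  obtain gx gz where g: "\<And>p. (g has_derivative (\<lambda>h. gx p * fst h + gz p * snd h)) (at p)"
    "C_k k gx" "C_k k gz" using Suc.prems(2) by (rule C_k_SucE) blast
  show ?case
  proof (rule C_k_SucI[of _ "\<lambda>p. fx p + gx p" "\<lambda>p. fz p + gz p"])
    fix p
    show "((\<lambda>p. f p + g p) has_derivative
        (\<lambda>h. (fx p + gx p) * fst h + (fz p + gz p) * snd h)) (at p)"
      by (rule has_derivative_eq_rhs[OF has_derivative_add[OF f(1) g(1)]])
        (auto simp: algebra_simps)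
  qed (intro Suc.IH f g)+
qed (auto intro!: continuous_intros)

lemma C_k_mult: "C_k k f \<Longrightarrow> C_k k g \<Longrightarrow> C_k k (\<lambda>p. f p * g p)"
proof (induction k arbitrary: f g)
  case (Suc k)
  obtain fx fz where f: "\<And>p. (f has_derivative (\<lambda>h. fx p * fst h + fz p * snd h)) (at p)"
    "C_k k fx" "C_k k fz" using Suc.prems(1) by (rule C_k_SucE) blast
  obtain gx gz where g: "\<And>p. (g has_derivative (\<lambda>h. gx p * fst h + gz p * snd h)) (at p)"
    "C_k k gx" "C_k k gz" using Suc.prems(2) by (rule C_k_SucE) blast
  show ?case
  proof (rule C_k_SucI[of _ "\<lambda>p. fx p * g p + f p * gx p" "\<lambda>p. fz p * g p + f p * gz p"])
    fix p
    show "((\<lambda>p. f p * g p) has_derivative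
        (\<lambda>h. (fx p * g p + f p * gx p) * fst h + (fz p * g p + f p * gz p) * snd h)) (at p)"
      by (rule has_derivative_eq_rhs[OF has_derivative_mult[OF f(1) g(1)]])
        (auto simp: algebra_simps)
  qed (intro C_k_add Suc.IH f g C_k_Suc_imp_C_k[OF Suc.prems(1)] C_k_Suc_imp_C_k[OF Suc.prems(2)])+
qed (auto intro!: continuous_intros)

text \<open>The induction step for composition with a function of one variable: it reduces \<open>C_k (Suc k)\<close> of
  \<open>g \<circ> f\<close> to \<open>C_k k\<close> of \<open>g' \<circ> f\<close>, so it applies to every family of functions that is closed under
  differentiation, such as \<open>exp\<close>, the pair \<open>sin\<close>, \<open>cos\<close>, and the family \<open>flat\<close> below.\<close>

lemma C_k_compose_derivative:
  assumes f: "C_k (Suc k) f" and g: "\<And>t. (g has_real_derivative g' t) (at t)"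
    and "C_k k (\<lambda>p. g' (f p))"
  shows "C_k (Suc k) (\<lambda>p. g (f p))"
proof -
  obtain fx fz where f: "\<And>p. (f has_derivative (\<lambda>h. fx p * fst h + fz p * snd h)) (at p)"
    "C_k k fx" "C_k k fz" using f by (rule C_k_SucE) blast
  show ?thesis
  proof (rule C_k_SucI[of _ "\<lambda>p. g' (f p) * fx p" "\<lambda>p. g' (f p) * fz p"])
    fix p
    show "((\<lambda>p. g (f p)) has_derivative
        (\<lambda>h. (g' (f p) * fx p) * fst h + (g' (f p) * fz p) * snd h)) (at p)"
      by (rule has_derivative_eq_rhs[OF has_derivative_compose[OF f(1) 
            g[of "f p", unfolded has_field_derivative_def]]])
        (auto simp: algebra_simps)
  qed (intro C_k_mult assms f)+
qed

lemma C_k_exp: "C_k k f \<Longrightarrow> C_k k (\<lambda>p. exp (f p))"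
proof (induction k)
  case (Suc k)
  show ?case
    by (rule C_k_compose_derivative[OF Suc.prems, of exp exp])
      (auto intro: Suc.IH C_k_Suc_imp_C_k[OF Suc.prems] DERIV_exp simp del: C_k.simps)
qed (auto intro!: continuous_intros)

lemma C_k_sin_cos: "C_k k f \<Longrightarrow> C_k k (\<lambda>p. sin (f p)) \<and> C_k k (\<lambda>p. cos (f p))"
proof (induction k)
  case (Suc k)
  have IH: "C_k k (\<lambda>p. sin (f p))" "C_k k (\<lambda>p. cos (f p))"
    using Suc.IH C_k_Suc_imp_C_k[OF Suc.prems] by auto
  have "C_k k (\<lambda>p. - sin (f p))"
    using C_k_mult[OF C_k_const[of k "-1"] IH(1)] by simp
  then show ?case
    using C_k_compose_derivative[OF Suc.prems DERIV_sin IH(2)]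
      C_k_compose_derivative[OF Suc.prems DERIV_cos] by blast
qed (auto intro!: continuous_intros)

text \<open>The functions \<open>t\<^sup>-\<^sup>j exp (-1 / t)\<close>, extended by zero to \<open>t \<le> 0\<close>, are the building block of all
  cutoffs. The powers of \<open>1 / t\<close> are included because this family is closed under differentiation up
  to linear combinations, which is what makes each member smooth at \<open>0\<close>.\<close>

definition flat :: "nat \<Rightarrow> real \<Rightarrow> real" where
  "flat j t = (if t \<le> 0 then 0 else (1 / t) ^ j * exp (- (1 / t)))"

text \<open>With \<open>y = 1 / t\<close> this is the fact that \<open>y ^ j / exp y\<close> vanishes at infinity.\<close>

lemma flat_tendsto_0: "(flat j \<longlongrightarrow> 0) (at 0)"
proof (rule filterlim_split_at)
  show "(flat j \<longlongrightarrow> 0) (at_left 0)"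
    by (rule tendsto_eventually) (auto simp: flat_def eventually_at_filter)
  have "((\<lambda>t::real. inverse t ^ j / exp (inverse t)) \<longlongrightarrow> 0) (at_right 0)"
    using tendsto_power_div_exp_0 filterlim_inverse_at_top_right by (rule filterlim_compose)
  then show "(flat j \<longlongrightarrow> 0) (at_right 0)"
    by (rule Lim_transform_eventually)
      (auto simp: flat_def eventually_at_filter exp_minus divide_simps)
qed

text \<open>At \<open>t = 0\<close> the difference quotient of \<open>flat j\<close> is \<open>flat (Suc j)\<close>, so differentiability there is
  the limit above for the next power.\<close>

lemma DERIV_flat:
  "(flat j has_real_derivative (flat (Suc (Suc j)) t - real j * flat (Suc j) t)) (at t)"
proof -
  consider "t < 0" | "t = 0" | "t > 0" by linarith
  then show ?thesis
  proof cases
    case 1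
    have "((\<lambda>t. 0) has_real_derivative (flat (Suc (Suc j)) t - real j * flat (Suc j) t)) (at t)"
      using 1 by (simp add: flat_def)
    then show ?thesis
      by (rule has_field_derivative_transform_within_open[of _ _ _ "{..<0}"])
        (use 1 in \<open>auto simp: flat_def\<close>)
  next
    case 2
    have "((\<lambda>h. (flat j (0 + h) - flat j 0) / h) \<longlongrightarrow> 0) (at 0)"
      by (rule Lim_transform_eventually[OF flat_tendsto_0[of "Suc j"]])
        (auto simp: flat_def eventually_at_filter)
    then show ?thesis
      unfolding 2 DERIV_def by (simp add: flat_def)
  next
    case 3
    have "((\<lambda>t. (1 / t) ^ j * exp (- (1 / t))) has_real_derivative
        (flat (Suc (Suc j)) t - real j * flat (Suc j) t)) (at t)"
      using 3
      by (auto intro!: derivative_eq_intros simp: flat_def)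
        (cases j; auto simp: divide_simps power2_eq_square algebra_simps)
    then show ?thesis
      by (rule has_field_derivative_transform_within_open[of _ _ _ "{0<..}"])
        (use 3 in \<open>auto simp: flat_def\<close>)
  qed
qed

lemma continuous_on_flat: "continuous_on UNIV (flat j)"
  using DERIV_isCont[OF DERIV_flat] by (simp add: continuous_at_imp_continuous_on)

lemma C_k_flat: "C_k k f \<Longrightarrow> C_k k (\<lambda>p. flat j (f p))"
proof (induction k arbitrary: j)
  case 0
  then show ?case
    using continuous_on_compose2[OF continuous_on_flat[of j], of UNIV f] by simp
next
  case (Suc k)
  have IH: "C_k k (\<lambda>p. flat j (f p))" for j
    by (intro Suc.IH C_k_Suc_imp_C_k[OF Suc.prems])
  have "C_k k (\<lambda>p. flat (Suc (Suc j)) (f p) + (- real j) * flat (Suc j) (f p))"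
    by (intro C_k_add C_k_mult C_k_const IH)
  then show ?case
    by (intro C_k_compose_derivative[OF Suc.prems DERIV_flat]) simp
qed

lemma flat_0_nonneg: "0 \<le> flat 0 t"
  by (simp add: flat_def)

lemma flat_0_eq_0_iff: "flat 0 t = 0 \<longleftrightarrow> t \<le> 0"
  by (simp add: flat_def)

lemma flat_0_mono: "s \<le> t \<Longrightarrow> flat 0 s \<le> flat 0 t"
  by (auto simp: flat_def intro!: divide_left_mono)

lemma smooth_const: "smooth (\<lambda>p. c)"
  and smooth_fst: "smooth fst"
  and smooth_snd: "smooth snd"
  and smooth_add: "smooth f \<Longrightarrow> smooth g \<Longrightarrow> smooth (\<lambda>p. f p + g p)"
  and smooth_mult: "smooth f \<Longrightarrow> smooth g \<Longrightarrow> smooth (\<lambda>p. f p * g p)"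
  and smooth_exp: "smooth f \<Longrightarrow> smooth (\<lambda>p. exp (f p))"
  and smooth_sin: "smooth f \<Longrightarrow> smooth (\<lambda>p. sin (f p))"
  and smooth_cos: "smooth f \<Longrightarrow> smooth (\<lambda>p. cos (f p))"
  and smooth_flat: "smooth f \<Longrightarrow> smooth (\<lambda>p. flat j (f p))"
  by (auto simp: smooth_def C_k_const C_k_fst C_k_snd C_k_add C_k_mult C_k_exp C_k_sin_cos C_k_flat
      simp del: C_k.simps)

lemma smooth_diff: "smooth f \<Longrightarrow> smooth g \<Longrightarrow> smooth (\<lambda>p. f p - g p)"
  using smooth_add[of f "\<lambda>p. (-1) * g p"] smooth_mult[OF smooth_const[of "-1"], of g] by simp

lemmas smooth_intros = smooth_const smooth_fst smooth_snd smooth_add smooth_diff smooth_mult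
  smooth_exp smooth_sin smooth_cos smooth_flat

lemma smooth_imp_continuous_on: "smooth f \<Longrightarrow> continuous_on S f"
  unfolding smooth_def by (metis C_k.simps(1) continuous_on_subset subset_UNIV)

lemma has_derivative_imp_partial_derivatives:
  assumes "(f has_derivative (\<lambda>h. a * fst h + b * snd h)) (at (x, z))"
  shows "((\<lambda>t. f (t, z)) has_real_derivative a) (at x)"
    and "((\<lambda>t. f (x, t)) has_real_derivative b) (at z)"
proof -
  have 1: "((\<lambda>t. (t, z)) has_derivative (\<lambda>h. (h, 0))) (at x)"
    and 2: "((\<lambda>t. (x, t)) has_derivative (\<lambda>h. (0, h))) (at z)"
    by (auto intro!: derivative_eq_intros)
  show "((\<lambda>t. f (t, z)) has_real_derivative a) (at x)"
    using has_derivative_compose[OF 1 assms] by (simp add: has_field_derivative_def)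
  show "((\<lambda>t. f (x, t)) has_real_derivative b) (at z)"
    using has_derivative_compose[OF 2 assms] by (simp add: has_field_derivative_def)
qed

lemma has_derivative_imp_partial_eq:
  assumes "\<And>p. (f has_derivative (\<lambda>h. fx p * fst h + fz p * snd h)) (at p)"
  shows "partial_x f = fx" "partial_z f = fz"
  using has_derivative_imp_partial_derivatives[OF assms, THEN DERIV_imp_deriv]
  by (auto simp: partial_x_def partial_z_def)

lemma smooth_has_derivative:
  assumes "smooth f"
  shows "(f has_derivative (\<lambda>h. partial_x f p * fst h + partial_z f p * snd h)) (at p)"
proof -
  have "C_k (Suc 0) f" using assms by (simp add: smooth_def del: C_k.simps)
  then show ?thesis
    by (rule C_k_SucE) (metis has_derivative_imp_partial_eq)
qed

lemma smooth_partial: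
  assumes "smooth f"
  shows "smooth (partial_x f)" "smooth (partial_z f)"
proof -
  have "C_k k (partial_x f) \<and> C_k k (partial_z f)" for k
  proof -
    have "C_k (Suc k) f" using assms by (simp add: smooth_def del: C_k.simps)
    then show ?thesis
      by (rule C_k_SucE) (metis has_derivative_imp_partial_eq)
  qed
  then show "smooth (partial_x f)" "smooth (partial_z f)"
    by (auto simp: smooth_def)
qed

lemma smooth_DERIV:
  assumes "smooth f"
  shows "((\<lambda>t. f (t, z)) has_real_derivative partial_x f (x, z)) (at x)"
    and "((\<lambda>t. f (x, t)) has_real_derivative partial_z f (x, z)) (at z)"
  using has_derivative_imp_partial_derivatives[OF smooth_has_derivative[OF assms]] by auto

lemma smooth_partial_funpow:
  assumes "smooth f"
  shows "smooth ((partial_x ^^ a) f)" "smooth ((partial_z ^^ b) f)"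
  by (induction a, use assms in \<open>auto intro: smooth_partial\<close>)
    (induction b, use assms in \<open>auto intro: smooth_partial\<close>)

lemma eq_0_outside_supp: "p \<notin> supp f \<Longrightarrow> f p = 0"
  using closure_subset[of "{p. f p \<noteq> 0}"] by (auto simp: supp_def)

lemma supp_subset_closed: "closed K \<Longrightarrow> (\<And>p. p \<notin> K \<Longrightarrow> f p = 0) \<Longrightarrow> supp f \<subseteq> K"
  unfolding supp_def by (rule closure_minimal) auto

lemma compact_supp_subset: "compact K \<Longrightarrow> (\<And>p. p \<notin> K \<Longrightarrow> f p = 0) \<Longrightarrow> compact (supp f)"
  using compact_Int_closed[of K "supp f"] supp_subset_closed[of K f] compact_imp_closed[of K]
  by (simp add: supp_def inf.absorb2)

text \<open>The complement of the support is open and the function vanishes on it. Hence differentiation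
  does not enlarge supports, and test functions are closed under partial derivatives.\<close>

lemma partial_eq_0_outside_supp:
  assumes f: "smooth f" and p: "p \<notin> supp f"
  shows "partial_x f p = 0" "partial_z f p = 0"
proof -
  have "((\<lambda>_. 0) has_derivative (\<lambda>_. 0)) (at p)" by simp
  moreover have "open (- supp f)"
    by (simp add: supp_def open_Compl)
  ultimately have "(f has_derivative (\<lambda>_. 0)) (at p)"
    by (rule has_derivative_transform_within_open) (use p eq_0_outside_supp[of _ f] in auto)
  from has_derivative_unique[OF this smooth_has_derivative[OF f]]
  have "0 = partial_x f p * fst h + partial_z f p * snd h" for h
    by meson
  from this[of "(1, 0)"] this[of "(0, 1)"] show "partial_x f p = 0" "partial_z f p = 0"
    by auto
qed

lemma test_fun_partial:
  assumes "\<theta> \<in> test_fun S"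
  shows "partial_x \<theta> \<in> test_fun S" "partial_z \<theta> \<in> test_fun S"
proof -
  have \<theta>: "smooth \<theta>" "compact (supp \<theta>)" "supp \<theta> \<subseteq> S"
    using assms by (auto simp: test_fun_def)
  have "supp (partial_x \<theta>) \<subseteq> supp \<theta>" "supp (partial_z \<theta>) \<subseteq> supp \<theta>"
    by (rule supp_subset_closed; use partial_eq_0_outside_supp[OF \<theta>(1)] in \<open>auto simp: supp_def\<close>)+
  moreover have "compact (supp (partial_x \<theta>))" "compact (supp (partial_z \<theta>))"
    by (rule compact_supp_subset[OF \<theta>(2)]; use partial_eq_0_outside_supp[OF \<theta>(1)] in blast)+
  ultimately show "partial_x \<theta> \<in> test_fun S" "partial_z \<theta> \<in> test_fun S"
    using \<theta> smooth_partial[OF \<theta>(1)] unfolding test_fun_def by blast+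
qed

section \<open>Integration over the rectangle\<close>

lemma Omega_eq_box: "Omega l = box (0, 0) (l, 1)"
  by (auto simp: Omega_def box_def Basis_prod_def)

lemma Omega_lmeasurable: "Omega l \<in> lmeasurable"
  unfolding Omega_eq_box by (rule lmeasurable_box)

lemma Omega_sets: "Omega l \<in> sets lebesgue"
  using Omega_lmeasurable by (rule fmeasurableD)

lemma integrable_on_Omega:
  fixes f :: "real \<times> real \<Rightarrow> real"
  assumes "continuous_on (cbox (0, 0) (l, 1)) f"
  shows "integrable (lebesgue_on (Omega l)) f"
proof -
  have "set_integrable lebesgue (cbox (0, 0) (l, 1)) f"
    using assms by (rule absolutely_integrable_continuous)
  then have "set_integrable lebesgue (Omega l) f"
    by (rule set_integrable_subset) (auto simp: Omega_sets Omega_eq_box box_subset_cbox)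
  then show ?thesis
    using Omega_sets[of l] by (simp add: integrable_restrict_space set_integrable_def)
qed

text \<open>The closed rectangle differs from the open one by a null set, and on the closed one Fubini's theorem
  for continuous functions applies.\<close>

lemma LINT_Omega:
  fixes f :: "real \<times> real \<Rightarrow> real"
  assumes "continuous_on (cbox (0, 0) (l, 1)) f"
  shows "(LINT p|lebesgue_on (Omega l). f p) = integral {0..l} (\<lambda>x. integral {0..1} (\<lambda>z. f (x, z)))"
  using lebesgue_integral_eq_integral[OF integrable_on_Omega[OF assms] Omega_sets]
    integral_prod_continuous[OF assms] integral_open_interval[of "(0, 0)" "(l, 1)" f]
  by (simp add: Omega_eq_box)

text \<open>Integrating first in the direction of differentiation, the fundamental theorem of calculus leaves
  only boundary values, which vanish.\<close>

lemma LINT_partial_eq_0: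
  assumes F: "smooth F" and zero: "\<And>p. p \<notin> Omega l \<Longrightarrow> F p = 0" and "l > 0"
  shows "(LINT p|lebesgue_on (Omega l). partial_x F p) = 0"
    and "(LINT p|lebesgue_on (Omega l). partial_z F p) = 0"
proof -
  have x: "integral {0..l} (\<lambda>x. partial_x F (x, z)) = 0" for z
  proof -
    have "((\<lambda>x. partial_x F (x, z)) has_integral F (l, z) - F (0, z)) {0..l}"
      using smooth_DERIV(1)[OF F, of z] \<open>l > 0\<close>
      by (intro fundamental_theorem_of_calculus)
        (auto simp: has_real_derivative_iff_has_vector_derivative[symmetric]
          intro: has_field_derivative_at_within)
    then show ?thesis
      using zero[of "(l, z)"] zero[of "(0, z)"] by (simp add: Omega_def integral_unique)
  qed
  have z: "integral {0..1} (\<lambda>z. partial_z F (x, z)) = 0" for x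
  proof -
    have "((\<lambda>z. partial_z F (x, z)) has_integral F (x, 1) - F (x, 0)) {0..1}"
      using smooth_DERIV(2)[OF F, of x]
      by (intro fundamental_theorem_of_calculus)
        (auto simp: has_real_derivative_iff_has_vector_derivative[symmetric]
          intro: has_field_derivative_at_within)
    then show ?thesis
      using zero[of "(x, 1)"] zero[of "(x, 0)"] by (simp add: Omega_def integral_unique)
  qed
  have c: "continuous_on (cbox (0, 0) (l, 1)) (partial_x F)"
    "continuous_on (cbox (0, 0) (l, 1)) (partial_z F)"
    using smooth_partial[OF F] by (auto intro: smooth_imp_continuous_on)
  then have "integral {0..l} (\<lambda>x. integral {0..1} (\<lambda>z. partial_x F (x, z)))
      = integral {0..1} (\<lambda>z. integral {0..l} (\<lambda>x. partial_x F (x, z)))"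
    using integral_swap_continuous[of 0 0 l 1 "\<lambda>x z. partial_x F (x, z)"] by simp
  then show "(LINT p|lebesgue_on (Omega l). partial_x F p) = 0"
    using LINT_Omega[OF c(1)] x by simp
  show "(LINT p|lebesgue_on (Omega l). partial_z F p) = 0"
    using LINT_Omega[OF c(2)] z by simp
qed

lemma smooth_partial_mult:
  assumes "smooth f" "smooth g"
  shows "partial_x (\<lambda>p. f p * g p) = (\<lambda>p. f p * partial_x g p + partial_x f p * g p)"
    and "partial_z (\<lambda>p. f p * g p) = (\<lambda>p. f p * partial_z g p + partial_z f p * g p)"
proof -
  have "((\<lambda>p. f p * g p) has_derivative (\<lambda>h. (f p * partial_x g p + partial_x f p * g p) * fst h
      + (f p * partial_z g p + partial_z f p * g p) * snd h)) (at p)" for p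
    by (rule has_derivative_eq_rhs[OF has_derivative_mult[OF smooth_has_derivative[OF assms(1)]
            smooth_has_derivative[OF assms(2)]]]) (simp add: algebra_simps)
  then show "partial_x (\<lambda>p. f p * g p) = (\<lambda>p. f p * partial_x g p + partial_x f p * g p)"
    and "partial_z (\<lambda>p. f p * g p) = (\<lambda>p. f p * partial_z g p + partial_z f p * g p)"
    by (rule has_derivative_imp_partial_eq)+
qed

lemma LINT_by_parts:
  assumes f: "smooth f" and \<theta>: "\<theta> \<in> test_fun (Omega l)" and "l > 0"
  shows "(LINT p|lebesgue_on (Omega l). f p * partial_x \<theta> p)
      = - (LINT p|lebesgue_on (Omega l). partial_x f p * \<theta> p)"
    and "(LINT p|lebesgue_on (Omega l). f p * partial_z \<theta> p)
      = - (LINT p|lebesgue_on (Omega l). partial_z f p * \<theta> p)"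
proof -
  have zero: "f p * \<theta> p = 0" if "p \<notin> Omega l" for p
    using \<theta> that eq_0_outside_supp[of p \<theta>] by (auto simp: test_fun_def)
  have s: "smooth \<theta>" using \<theta> by (auto simp: test_fun_def)
  have i: "integrable (lebesgue_on (Omega l)) (\<lambda>p. g p * h p)" if "smooth g" "smooth h" for g h
    by (intro integrable_on_Omega smooth_imp_continuous_on smooth_mult that)
  note p = smooth_partial[OF f] smooth_partial[OF s]
  note 0 = LINT_partial_eq_0[OF smooth_mult[OF f s] zero \<open>l > 0\<close>, unfolded smooth_partial_mult[OF f s]]
  show "(LINT p|lebesgue_on (Omega l). f p * partial_x \<theta> p)
      = - (LINT p|lebesgue_on (Omega l). partial_x f p * \<theta> p)"
    using 0(1) Bochner_Integration.integral_add[OF i[OF f p(3)] i[OF p(1) s]] by simp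
  show "(LINT p|lebesgue_on (Omega l). f p * partial_z \<theta> p)
      = - (LINT p|lebesgue_on (Omega l). partial_z f p * \<theta> p)"
    using 0(2) Bochner_Integration.integral_add[OF i[OF f p(4)] i[OF p(2) s]] by simp
qed

lemma LINT_by_parts_funpow:
  assumes "smooth f" and "\<theta> \<in> test_fun (Omega l)" and "l > 0"
  shows "(LINT p|lebesgue_on (Omega l). f p * (partial_x ^^ k) \<theta> p)
      = (-1) ^ k * (LINT p|lebesgue_on (Omega l). (partial_x ^^ k) f p * \<theta> p)"
    and "(LINT p|lebesgue_on (Omega l). f p * (partial_z ^^ k) \<theta> p)
      = (-1) ^ k * (LINT p|lebesgue_on (Omega l). (partial_z ^^ k) f p * \<theta> p)"
  using assms(1,2)
proof (induction k arbitrary: \<theta>)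
  case (Suc k)
  {
    case 1
    show ?case
      using Suc.IH(1)[OF 1(1) test_fun_partial(1)[OF 1(2)]]
        LINT_by_parts(1)[OF smooth_partial_funpow(1)[OF 1(1), of k] 1(2) \<open>l > 0\<close>]
      by (simp add: funpow_swap1)
  next
    case 2
    show ?case
      using Suc.IH(2)[OF 2(1) test_fun_partial(2)[OF 2(2)]]
        LINT_by_parts(2)[OF smooth_partial_funpow(2)[OF 2(1), of k] 2(2) \<open>l > 0\<close>]
      by (simp add: funpow_swap1)
  }
qed simp_all

lemma test_fun_partial_funpow:
  "\<theta> \<in> test_fun S \<Longrightarrow> (partial_z ^^ k) \<theta> \<in> test_fun S"
  by (induction k) (auto intro: test_fun_partial)

text \<open>The derivatives are moved from the test function to \<open>f\<close> from the outside to the inside, which is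
  why they arrive at \<open>f\<close> in the opposite order.\<close>

lemma smooth_imp_is_weak_deriv:
  assumes f: "smooth f" and "l > 0"
  shows "is_weak_deriv (Omega l) a b f ((partial_z ^^ b) ((partial_x ^^ a) f))"
  unfolding is_weak_deriv_def
proof
  fix \<theta> assume \<theta>: "\<theta> \<in> test_fun (Omega l)"
  show "(LINT p|lebesgue_on (Omega l). f p * (partial_x ^^ a) ((partial_z ^^ b) \<theta>) p) =
         (- 1) ^ (a + b) *
         (LINT p|lebesgue_on (Omega l). (partial_z ^^ b) ((partial_x ^^ a) f) p * \<theta> p)"
    using LINT_by_parts_funpow(1)[OF f test_fun_partial_funpow[OF \<theta>] \<open>l > 0\<close>]
      LINT_by_parts_funpow(2)[OF smooth_partial_funpow(1)[OF f] \<theta> \<open>l > 0\<close>]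
    by (simp add: power_add)
qed

section \<open>The space of square integrable functions\<close>

lemma L2_D:
  assumes "f \<in> L2 S"
  shows "f \<in> borel_measurable (lebesgue_on S)" "integrable (lebesgue_on S) (\<lambda>p. (f p)\<^sup>2)"
  using assms by (auto simp: L2_def)

lemma L2_mult_integrable:
  assumes "f \<in> L2 S" "g \<in> L2 S"
  shows "integrable (lebesgue_on S) (\<lambda>p. f p * g p)"
proof (rule Bochner_Integration.integrable_bound)
  show "integrable (lebesgue_on S) (\<lambda>p. (f p)\<^sup>2 + (g p)\<^sup>2)"
    using assms by (intro Bochner_Integration.integrable_add L2_D)
  show "(\<lambda>p. f p * g p) \<in> borel_measurable (lebesgue_on S)"
    using assms by (intro borel_measurable_times L2_D)
  have "\<bar>a * b\<bar> \<le> a\<^sup>2 + b\<^sup>2" for a b :: real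
  proof -
    have "2 * \<bar>a * b\<bar> \<le> a\<^sup>2 + b\<^sup>2"
      using sum_squares_bound[of "\<bar>a\<bar>" "\<bar>b\<bar>"] by (simp add: abs_mult mult.assoc)
    then show ?thesis using abs_ge_zero[of "a * b"] by linarith
  qed
  then show "AE p in lebesgue_on S. norm (f p * g p) \<le> norm ((f p)\<^sup>2 + (g p)\<^sup>2)"
    by simp
qed

lemma L2_add: "f \<in> L2 S \<Longrightarrow> g \<in> L2 S \<Longrightarrow> (\<lambda>p. f p + g p) \<in> L2 S"
proof -
  assume f: "f \<in> L2 S" and g: "g \<in> L2 S"
  have "integrable (lebesgue_on S) (\<lambda>p. (f p)\<^sup>2 + (g p)\<^sup>2 + 2 * (f p * g p))"
    by (intro Bochner_Integration.integrable_add integrable_mult_right L2_mult_integrable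
        L2_D(2) f g)
  moreover have "(\<lambda>p. f p + g p) \<in> borel_measurable (lebesgue_on S)"
    by (intro borel_measurable_add L2_D(1) f g)
  ultimately show ?thesis
    unfolding L2_def by (simp add: power2_sum mult.assoc)
qed

lemma L2_scale: "f \<in> L2 S \<Longrightarrow> (\<lambda>p. c * f p) \<in> L2 S"
proof -
  assume f: "f \<in> L2 S"
  have "integrable (lebesgue_on S) (\<lambda>p. c\<^sup>2 * (f p)\<^sup>2)"
    by (intro integrable_mult_right L2_D(2) f)
  moreover have "(\<lambda>p. c * f p) \<in> borel_measurable (lebesgue_on S)"
    by (intro borel_measurable_times borel_measurable_const L2_D(1) f)
  ultimately show ?thesis
    unfolding L2_def by (simp add: power_mult_distrib)
qed

lemma L2_diff: "f \<in> L2 S \<Longrightarrow> g \<in> L2 S \<Longrightarrow> (\<lambda>p. f p - g p) \<in> L2 S"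
  using L2_add[of f S "\<lambda>p. (-1) * g p"] L2_scale[of g S "-1"] by simp

lemma L2_zero: "(\<lambda>p. 0) \<in> L2 S"
  by (simp add: L2_def)

lemma L2_sum: "(\<And>t. t \<in> F \<Longrightarrow> g t \<in> L2 S) \<Longrightarrow> (\<lambda>p. \<Sum>t\<in>F. g t p) \<in> L2 S"
  by (induction F rule: infinite_finite_induct) (auto intro: L2_zero L2_add)

lemma bounded_imp_L2:
  assumes f: "f \<in> borel_measurable (lebesgue_on S)" and S: "S \<in> lmeasurable"
    and B: "\<And>p. p \<in> S \<Longrightarrow> \<bar>f p\<bar> \<le> B"
  shows "f \<in> L2 S"
proof -
  interpret finite_measure "lebesgue_on S" using S by (rule finite_measure_lebesgue_on)
  have "AE p in lebesgue_on S. norm ((f p)\<^sup>2) \<le> B\<^sup>2"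
    by (rule AE_I2) (use B in \<open>force simp: abs_le_square_iff[symmetric] intro: order_trans\<close>)
  then have "integrable (lebesgue_on S) (\<lambda>p. (f p)\<^sup>2)"
    by (rule integrable_const_bound) (use f in simp)
  then show ?thesis using f by (simp add: L2_def)
qed

lemma smooth_imp_L2: "smooth f \<Longrightarrow> f \<in> L2 (Omega l)"
  unfolding L2_def power2_eq_square
  by (auto intro!: integrable_on_Omega smooth_imp_continuous_on smooth_mult
      continuous_imp_measurable_on_sets_lebesgue Omega_sets)

definition L2_inner :: "(real \<times> real) set \<Rightarrow> (real \<times> real \<Rightarrow> real) \<Rightarrow> (real \<times> real \<Rightarrow> real) \<Rightarrow> real" where
  "L2_inner S f g = (LINT p|lebesgue_on S. f p * g p)"

lemma L2_norm_nonneg: "0 \<le> L2_norm S f"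
  by (simp add: L2_norm_def)

lemma L2_norm_power2: "(L2_norm S f)\<^sup>2 = L2_inner S f f"
  by (simp add: L2_norm_def L2_inner_def power2_eq_square)

lemma L2_inner_commute: "L2_inner S f g = L2_inner S g f"
  by (simp add: L2_inner_def mult.commute)

lemma L2_inner_add:
  assumes "f \<in> L2 S" "g \<in> L2 S" "h \<in> L2 S"
  shows "L2_inner S (\<lambda>p. f p + g p) h = L2_inner S f h + L2_inner S g h"
  using assms by (simp add: L2_inner_def distrib_right L2_mult_integrable)

lemma L2_inner_add_right:
  assumes "f \<in> L2 S" "g \<in> L2 S" "h \<in> L2 S"
  shows "L2_inner S h (\<lambda>p. f p + g p) = L2_inner S h f + L2_inner S h g"
  using L2_inner_add[OF assms] by (simp only: L2_inner_commute[of S h])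

lemma L2_inner_diff:
  assumes "f \<in> L2 S" "g \<in> L2 S" "h \<in> L2 S"
  shows "L2_inner S (\<lambda>p. f p - g p) h = L2_inner S f h - L2_inner S g h"
  using assms by (simp add: L2_inner_def left_diff_distrib L2_mult_integrable)

lemma L2_inner_diff_right:
  assumes "f \<in> L2 S" "g \<in> L2 S" "h \<in> L2 S"
  shows "L2_inner S h (\<lambda>p. f p - g p) = L2_inner S h f - L2_inner S h g"
  using L2_inner_diff[OF assms] by (simp only: L2_inner_commute[of S h])

lemma L2_inner_scale: "L2_inner S (\<lambda>p. c * f p) h = c * L2_inner S f h"
  by (simp add: L2_inner_def mult.assoc)

lemma L2_inner_scale_right: "L2_inner S h (\<lambda>p. c * f p) = c * L2_inner S h f"
  using L2_inner_scale[of S c f h] by (simp only: L2_inner_commute[of S h])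

lemma L2_inner_sum:
  assumes "\<And>t. t \<in> F \<Longrightarrow> g t \<in> L2 S" "h \<in> L2 S"
  shows "L2_inner S (\<lambda>p. \<Sum>t\<in>F. g t p) h = (\<Sum>t\<in>F. L2_inner S (g t) h)"
  unfolding L2_inner_def sum_distrib_right
  by (rule Bochner_Integration.integral_sum) (use assms in \<open>auto intro: L2_mult_integrable\<close>)

text \<open>The quadratic polynomial \<open>t \<mapsto> \<parallel>f + t g\<parallel>\<^sup>2\<close> is nonnegative; it is evaluated at its minimum
  \<open>- \<langle>f, g\<rangle> / \<parallel>g\<parallel>\<^sup>2\<close>, and in the degenerate case \<open>\<parallel>g\<parallel> = 0\<close> at a point where a nonconstant affine
  function would be negative.\<close>

lemma L2_Cauchy_Schwarz:
  assumes f: "f \<in> L2 S" and g: "g \<in> L2 S"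
  shows "\<bar>L2_inner S f g\<bar> \<le> L2_norm S f * L2_norm S g"
proof -
  let ?A = "L2_inner S f f" and ?B = "L2_inner S f g" and ?C = "L2_inner S g g"
  have pos: "0 \<le> ?A + 2 * t * ?B + t\<^sup>2 * ?C" for t
  proof -
    have tg: "(\<lambda>p. t * g p) \<in> L2 S" using g by (rule L2_scale)
    have "0 \<le> L2_inner S (\<lambda>p. f p + t * g p) (\<lambda>p. f p + t * g p)"
      by (simp add: L2_inner_def)
    also have "\<dots> = (?A + t * ?B) + t * (L2_inner S g f + t * ?C)"
      unfolding L2_inner_add[OF f tg L2_add[OF f tg]] L2_inner_scale
        L2_inner_add_right[OF f tg f] L2_inner_add_right[OF f tg g] L2_inner_scale_right ..
    also have "\<dots> = ?A + 2 * t * ?B + t\<^sup>2 * ?C"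
      unfolding L2_inner_commute[of S g f] by (simp add: power2_eq_square algebra_simps)
    finally show ?thesis .
  qed
  have "?B\<^sup>2 \<le> ?A * ?C"
  proof (cases "?C = 0")
    case True
    have "?B = 0"
    proof (rule ccontr)
      assume "?B \<noteq> 0"
      then have "2 * (- (?A + 1) / (2 * ?B)) * ?B = - (?A + 1)" by simp
      with pos[of "- (?A + 1) / (2 * ?B)"] True show False by simp
    qed
    then show ?thesis using True by simp
  next
    case False
    moreover have "0 \<le> ?C" by (simp add: L2_inner_def)
    ultimately have C: "?C > 0" by simp
    have "0 \<le> ?A - ?B\<^sup>2 / ?C"
      using pos[of "- ?B / ?C"] C by (simp add: power2_eq_square field_simps)
    then show ?thesis using C by (simp add: field_simps)
  qed
  also have "\<dots> = (L2_norm S f * L2_norm S g)\<^sup>2"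
    by (simp add: power_mult_distrib L2_norm_power2)
  finally show ?thesis
    using abs_le_square_iff[of ?B "L2_norm S f * L2_norm S g"] by (simp add: L2_norm_nonneg)
qed

lemma L2_norm_triangle:
  assumes "f \<in> L2 S" "g \<in> L2 S" "h \<in> L2 S"
  shows "L2_norm S (\<lambda>p. f p - h p) \<le> L2_norm S (\<lambda>p. f p - g p) + L2_norm S (\<lambda>p. g p - h p)"
proof (rule power2_le_imp_le)
  define u v where "u = (\<lambda>p. f p - g p)" and "v = (\<lambda>p. g p - h p)"
  have uv: "u \<in> L2 S" "v \<in> L2 S" using assms by (auto simp: u_def v_def intro: L2_diff)
  have "(\<lambda>p. f p - h p) = (\<lambda>p. u p + v p)" by (auto simp: u_def v_def)
  then have "(L2_norm S (\<lambda>p. f p - h p))\<^sup>2 = L2_inner S (\<lambda>p. u p + v p) (\<lambda>p. u p + v p)"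
    by (simp only: L2_norm_power2)
  also have "\<dots> = (L2_norm S u)\<^sup>2 + 2 * L2_inner S u v + (L2_norm S v)\<^sup>2"
    unfolding L2_inner_add[OF uv L2_add[OF uv]] L2_inner_add_right[OF uv uv(1)]
      L2_inner_add_right[OF uv uv(2)] L2_norm_power2 L2_inner_commute[of S v u] by simp
  also have "\<dots> \<le> (L2_norm S u + L2_norm S v)\<^sup>2"
    using L2_Cauchy_Schwarz[OF uv] by (simp add: power2_sum)
  finally show "(L2_norm S (\<lambda>p. f p - h p))\<^sup>2
    \<le> (L2_norm S (\<lambda>p. f p - g p) + L2_norm S (\<lambda>p. g p - h p))\<^sup>2"
    by (simp add: u_def v_def)
qed (simp add: L2_norm_nonneg)

lemma L2_norm_eq_0_iff:
  assumes "f \<in> L2 S"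
  shows "L2_norm S f = 0 \<longleftrightarrow> (AE p in lebesgue_on S. f p = 0)"
  using integral_nonneg_eq_0_iff_AE[OF L2_D(2)[OF assms]] by (simp add: L2_norm_def)

lemma L2_tendsto_dominated:
  assumes f: "f \<in> borel_measurable (lebesgue_on S)"
    and s: "\<And>k. s k \<in> borel_measurable (lebesgue_on S)" and w: "w \<in> L2 S"
    and lim: "AE p in lebesgue_on S. (\<lambda>k. s k p) \<longlonglongrightarrow> f p"
    and bound: "\<And>k. AE p in lebesgue_on S. \<bar>f p - s k p\<bar> \<le> w p"
  shows "(\<lambda>k. L2_norm S (\<lambda>p. f p - s k p)) \<longlonglongrightarrow> 0"
proof -
  have "(\<lambda>k. LINT p|lebesgue_on S. (f p - s k p)\<^sup>2) \<longlonglongrightarrow> (LINT p|lebesgue_on S. 0)"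
  proof (rule integral_dominated_convergence[OF _ _ L2_D(2)[OF w]])
    show "(\<lambda>p. (f p - s k p)\<^sup>2) \<in> borel_measurable (lebesgue_on S)" for k
      using f s[of k] by simp
    show "AE p in lebesgue_on S. (\<lambda>k. (f p - s k p)\<^sup>2) \<longlonglongrightarrow> 0"
      using lim
    proof eventually_elim
      case (elim p)
      from tendsto_power[OF tendsto_diff[OF tendsto_const elim], of "f p" 2] show ?case by simp
    qed
    show "AE p in lebesgue_on S. norm ((f p - s k p)\<^sup>2) \<le> (w p)\<^sup>2" for k
      using bound[of k]
    proof eventually_elim
      case (elim p)
      then show ?case using power_mono[OF elim, of 2] by simp
    qed
  qed simp
  from tendsto_real_sqrt[OF this] show ?thesis by (simp add: L2_norm_def)
qed

section \<open>Density of the trigonometric products\<close>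

text \<open>The linear span of the functions \<open>cos (2 \<pi> m x / l) sin (n \<pi> z)\<close> and
  \<open>sin (2 \<pi> m x / l) sin (n \<pi> z)\<close>. All integer frequencies are admitted, so that the
  product-to-sum formulas need no case distinction.\<close>

inductive_set trig_span :: "real \<Rightarrow> (real \<times> real \<Rightarrow> real) set" for l where
  cos: "(\<lambda>p. cos (of_int m * (2 * pi / l * fst p)) * sin (of_int n * (pi * snd p))) \<in> trig_span l"
| sin: "(\<lambda>p. sin (of_int m * (2 * pi / l * fst p)) * sin (of_int n * (pi * snd p))) \<in> trig_span l"
| add: "s \<in> trig_span l \<Longrightarrow> t \<in> trig_span l \<Longrightarrow> (\<lambda>p. s p + t p) \<in> trig_span l"
| scale: "s \<in> trig_span l \<Longrightarrow> (\<lambda>p. c * s p) \<in> trig_span l"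

lemma trig_span_cong: "s \<in> trig_span l \<Longrightarrow> (\<And>p. s p = t p) \<Longrightarrow> t \<in> trig_span l"
  by (metis ext)

lemma trig_product_to_sum:
  fixes X s :: real
  shows "(1/2) * (cos (of_int (m + 1) * X) * s + cos (of_int (m - 1) * X) * s) = cos X * (cos (of_int m * X) * s)"
    and "(1/2) * (sin (of_int (m + 1) * X) * s + sin (of_int (m - 1) * X) * s) = cos X * (sin (of_int m * X) * s)"
    and "(1/2) * (sin (of_int (m + 1) * X) * s + (-1) * (sin (of_int (m - 1) * X) * s)) = sin X * (cos (of_int m * X) * s)"
    and "(1/2) * (cos (of_int (m - 1) * X) * s + (-1) * (cos (of_int (m + 1) * X) * s)) = sin X * (sin (of_int m * X) * s)"
    and "(1/2) * (s * sin (of_int (m + 1) * X) + s * sin (of_int (m - 1) * X)) = cos X * (s * sin (of_int m * X))"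
  by (simp_all add: distrib_right left_diff_distrib cos_add cos_diff sin_add sin_diff)
    (simp_all add: algebra_simps)

text \<open>By the product-to-sum formulas the span is a module over the polynomials in these three functions.
  This is what turns a polynomial approximation into an element of the span.\<close>

lemma trig_span_mult_generators:
  assumes "s \<in> trig_span l"
  shows "(\<lambda>p. cos (2 * pi / l * fst p) * s p) \<in> trig_span l"
    and "(\<lambda>p. sin (2 * pi / l * fst p) * s p) \<in> trig_span l"
    and "(\<lambda>p. cos (pi * snd p) * s p) \<in> trig_span l"
  using assms
proof induction
  case (cos m n)
  {
    case 1
    show ?case
      by (rule trig_span_cong[OF _ trig_product_to_sum(1)])
        (intro trig_span.scale trig_span.add trig_span.cos)
  next
    case 2
    show ?case
      by (rule trig_span_cong[OF _ trig_product_to_sum(3)])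
        (intro trig_span.scale trig_span.add trig_span.sin)
  next
    case 3
    show ?case
      by (rule trig_span_cong[OF _ trig_product_to_sum(5)])
        (intro trig_span.scale trig_span.add trig_span.cos)
  }
next
  case (sin m n)
  {
    case 1
    show ?case
      by (rule trig_span_cong[OF _ trig_product_to_sum(2)])
        (intro trig_span.scale trig_span.add trig_span.sin)
  next
    case 2
    show ?case
      by (rule trig_span_cong[OF _ trig_product_to_sum(4)])
        (intro trig_span.scale trig_span.add trig_span.cos)
  next
    case 3
    show ?case
      by (rule trig_span_cong[OF _ trig_product_to_sum(5)])
        (intro trig_span.scale trig_span.add trig_span.sin)
  }
next
  case (add s t)
  {
    case 1
    from trig_span.add[OF add.IH(1) add.IH(4)] show ?case by (simp add: distrib_left)
  next
    case 2
    from trig_span.add[OF add.IH(2) add.IH(5)] show ?case by (simp add: distrib_left)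
  next
    case 3
    from trig_span.add[OF add.IH(3) add.IH(6)] show ?case by (simp add: distrib_left)
  }
next
  case (scale s c)
  {
    case 1
    from trig_span.scale[OF scale.IH(1), of c] show ?case by (simp only: mult.left_commute[of c])
  next
    case 2
    from trig_span.scale[OF scale.IH(2), of c] show ?case by (simp only: mult.left_commute[of c])
  next
    case 3
    from trig_span.scale[OF scale.IH(3), of c] show ?case by (simp only: mult.left_commute[of c])
  }
qed

text \<open>These coordinates wrap the closed rectangle onto a cylinder: they glue the sides \<open>x = 0\<close> and
  \<open>x = l\<close> and identify nothing else. The coordinate \<open>cos (\<pi> z)\<close> alone separates the points of \<open>[0, 1]\<close>.\<close>

definition trig_coords :: "real \<Rightarrow> real \<times> real \<Rightarrow> real \<times> real \<times> real" where
  "trig_coords l p = (cos (2 * pi / l * fst p), sin (2 * pi / l * fst p), cos (pi * snd p))"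

lemma trig_span_mult_polynomial:
  assumes "real_polynomial_function P"
  shows "s \<in> trig_span l \<Longrightarrow> (\<lambda>p. P (trig_coords l p) * s p) \<in> trig_span l"
  using assms
proof (induction P arbitrary: s rule: real_polynomial_function.induct)
  case (linear f)
  interpret bounded_linear f by (rule linear.hyps)
  obtain c1 c2 c3 where f: "\<And>a b c. f (a, b, c) = c1 * a + (c2 * b + c3 * c)"
  proof
    fix a b c :: real
    have "(a, b, c) = a *\<^sub>R (1, 0, 0) + (b *\<^sub>R (0, 1, 0) + c *\<^sub>R (0, 0, 1))" by simp
    then show "f (a, b, c) = f (1, 0, 0) * a + (f (0, 1, 0) * b + f (0, 0, 1) * c)"
      by (simp only: add scale real_scaleR_def mult.commute)
  qed
  note g = trig_span_mult_generators[OF linear.prems]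
  have "(\<lambda>p. c1 * (cos (2 * pi / l * fst p) * s p)
      + (c2 * (sin (2 * pi / l * fst p) * s p) + c3 * (cos (pi * snd p) * s p))) \<in> trig_span l"
    by (intro trig_span.add trig_span.scale g)
  then show ?case
    by (rule trig_span_cong) (simp only: trig_coords_def f distrib_right mult.assoc)
next
  case (const c)
  then show ?case by (rule trig_span.scale)
next
  case (add f g)
  from trig_span.add[OF add.IH(1)[OF add.prems] add.IH(2)[OF add.prems]]
  show ?case by (rule trig_span_cong) (simp only: distrib_right)
next
  case (mult f g)
  from mult.IH(1)[OF mult.IH(2)[OF mult.prems]]
  show ?case by (rule trig_span_cong) (simp only: mult.assoc)
qed

lemma trig_span_smooth: "s \<in> trig_span l \<Longrightarrow> smooth s"
  by (induction rule: trig_span.induct) (intro smooth_intros; assumption)+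

lemma trig_coords_eq_imp:
  assumes "l > 0" and xz: "0 \<le> x" "x \<le> l" "0 \<le> z" "z \<le> 1" "0 \<le> x'" "x' \<le> l" "0 \<le> z'" "z' \<le> 1"
    and eq: "trig_coords l (x, z) = trig_coords l (x', z')"
  shows "z = z'" and "x = x' \<or> x = 0 \<and> x' = l \<or> x = l \<and> x' = 0"
proof -
  have "cos (pi * z) = cos (pi * z')"
    using eq by (simp add: trig_coords_def)
  then have "pi * z = pi * z'"
    by (rule cos_inj_pi[rotated 4]) (use xz in auto)
  then show "z = z'" by simp
  have "sin (2 * pi / l * x) = sin (2 * pi / l * x') \<and> cos (2 * pi / l * x) = cos (2 * pi / l * x')"
    using eq by (simp add: trig_coords_def)
  then obtain k :: int where "2 * pi / l * x = 2 * pi / l * x' + 2 * pi * k"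
    unfolding sin_cos_eq_iff by blast
  then have "2 * pi * x = 2 * pi * (x' + l * k)"
    using \<open>l > 0\<close> by (simp add: field_simps)
  then have k: "x = x' + l * k" by simp
  have "l * k \<le> l * 1" "l * (-1) \<le> l * k" using k xz by auto
  then have "real_of_int k \<le> 1" "- 1 \<le> real_of_int k"
    using \<open>l > 0\<close> mult_le_cancel_left_pos by blast+
  then have "k = -1 \<or> k = 0 \<or> k = 1" by linarith
  then show "x = x' \<or> x = 0 \<and> x' = l \<or> x = l \<and> x' = 0"
    using k xz by auto
qed

lemma image_Int_vimage_factor:
  "(\<And>p. p \<in> B \<Longrightarrow> G (q p) = f p) \<Longrightarrow> q ` (B \<inter> (f -` C \<inter> B)) = G -` C \<inter> q ` B"
  by auto

text \<open>A continuous function that is compatible with the gluing factors through a function \<open>G\<close> on the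
  cylinder. This \<open>G\<close> is continuous because the rectangle is compact: the preimage of a closed set under
  \<open>G\<close> is the image of a compact set. The Weierstrass theorem then applies to \<open>G\<close>.\<close>

lemma trig_polynomial_approximation:
  fixes \<gamma> :: "real \<times> real \<Rightarrow> real"
  assumes "l > 0" and \<gamma>: "continuous_on (cbox (0, 0) (l, 1)) \<gamma>"
    and periodic: "\<And>z. \<gamma> (0, z) = \<gamma> (l, z)" and "e > 0"
  obtains P where "real_polynomial_function P"
    "\<And>p. p \<in> cbox (0, 0) (l, 1) \<Longrightarrow> \<bar>\<gamma> p - P (trig_coords l p)\<bar> < e"
proof -
  let ?B = "cbox (0, 0) (l, 1) :: (real \<times> real) set"
  define G where "G u = \<gamma> (inv_into ?B (trig_coords l) u)" for u
  have eq: "\<gamma> p = \<gamma> p'" if "p \<in> ?B" "p' \<in> ?B" "trig_coords l p = trig_coords l p'" for p p'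
    using that trig_coords_eq_imp[OF \<open>l > 0\<close>, of "fst p" "snd p" "fst p'" "snd p'"] periodic
    by (cases p; cases p') auto
  have G: "G (trig_coords l p) = \<gamma> p" if "p \<in> ?B" for p
    unfolding G_def
    by (rule eq) (use that in \<open>auto intro!: inv_into_into f_inv_into_f simp del: cbox_Pair_iff\<close>)
  have q: "continuous_on S (trig_coords l)" for S
    unfolding trig_coords_def by (intro continuous_intros)
  have comp: "compact (trig_coords l ` C)" if "compact C" for C
    using q that by (rule compact_continuous_image)
  have "continuous_on (trig_coords l ` ?B) G"
  proof (subst continuous_on_closed_vimage)
    show "closed (trig_coords l ` ?B)"
      by (intro compact_imp_closed comp compact_cbox)
    show "\<forall>C. closed C \<longrightarrow> closed (G -` C \<inter> trig_coords l ` ?B)"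
    proof (intro allI impI)
      fix C :: "real set" assume "closed C"
      then have "closed (\<gamma> -` C \<inter> ?B)"
        using \<gamma> by (intro closed_vimage_Int closed_cbox)
      then have "compact (?B \<inter> (\<gamma> -` C \<inter> ?B))"
        by (intro compact_Int_closed compact_cbox)
      then have "closed (trig_coords l ` (?B \<inter> (\<gamma> -` C \<inter> ?B)))"
        by (intro compact_imp_closed comp)
      moreover have "trig_coords l ` (?B \<inter> (\<gamma> -` C \<inter> ?B)) = G -` C \<inter> trig_coords l ` ?B"
        using G by (rule image_Int_vimage_factor)
      ultimately show "closed (G -` C \<inter> trig_coords l ` ?B)" by simp
    qed
  qed
  then obtain P where P: "real_polynomial_function P"
    "\<And>u. u \<in> trig_coords l ` ?B \<Longrightarrow> \<bar>G u - P u\<bar> < e"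
    using Stone_Weierstrass_real_polynomial_function[OF comp[OF compact_cbox] _ \<open>e > 0\<close>] by metis
  show ?thesis
    by (rule that[OF P(1)]) (use P(2) G in \<open>metis imageI\<close>)
qed


lemma eventually_Suc_mult_ge_1:
  fixes c :: real
  assumes "c > 0"
  shows "eventually (\<lambda>k. 1 \<le> real (Suc k) * c) sequentially"
proof -
  obtain N :: nat where N: "1 < real N * c"
    using reals_Archimedean3[OF assms] by blast
  show ?thesis
  proof (rule eventually_sequentiallyI[of N])
    fix k assume "N \<le> k"
    then have "real N * c \<le> real (Suc k) * c"
      using assms by (intro mult_right_mono) auto
    with N show "1 \<le> real (Suc k) * c" by linarith
  qed
qed

lemma AE_lebesgue_on_negligible:
  assumes "negligible N" "S \<in> sets lebesgue" "\<And>p. p \<in> S \<Longrightarrow> p \<notin> N \<Longrightarrow> P p"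
  shows "AE p in lebesgue_on S. P p"
proof -
  have "AE p in lebesgue. p \<notin> N"
    using assms(1) by (intro AE_not_in) (simp add: negligible_iff_null_sets)
  then have "AE p in lebesgue. p \<in> S \<longrightarrow> P p"
    by eventually_elim (use assms(3) in blast)
  then show ?thesis
    using assms(2) by (simp add: AE_restrict_space_iff)
qed

text \<open>A measurable function is almost everywhere the limit of continuous functions \<open>g k\<close>. These are
  clipped to \<open>[-M, M]\<close>, multiplied by a factor \<open>a k\<close> that vanishes on the sides \<open>x = 0\<close>, \<open>x = l\<close> and tends to \<open>1\<close>
  inside, and divided by \<open>sin (\<pi> z)\<close>, bounded away from zero by \<open>d k\<close>. The quotient \<open>\<gamma> k\<close> is
  continuous and periodic, hence uniformly close to a trigonometric polynomial. Multiplying back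
  by \<open>sin (\<pi> z)\<close> yields elements of the span that are uniformly bounded and converge almost
  everywhere to \<open>f\<close>, and dominated convergence gives convergence in \<open>L\<^sup>2\<close>.\<close>

lemma trig_span_dense_bounded:
  assumes "l > 0" and f: "f \<in> borel_measurable (lebesgue_on (Omega l))"
    and M: "\<And>p. \<bar>f p\<bar> \<le> M" and "e > 0"
  shows "\<exists>s\<in>trig_span l. L2_norm (Omega l) (\<lambda>p. f p - s p) < e"
proof -
  have "(\<lambda>p. if p \<in> Omega l then f p else 0) \<in> borel_measurable lebesgue"
    using f borel_measurable_if[OF Omega_sets] by blast
  then have "(\<lambda>p. if p \<in> Omega l then f p else 0) measurable_on UNIV"
    by (rule lebesgue_measurable_imp_measurable_on_real) simp
  then obtain N g where N: "negligible N" and g: "\<And>k. continuous_on UNIV (g k)"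
    and lim: "\<And>p. p \<notin> N \<Longrightarrow> (\<lambda>k. g k p) \<longlonglongrightarrow> (if p \<in> Omega l then f p else 0)"
    unfolding measurable_on_def by auto
  have M0: "0 \<le> M" using M[of undefined] by linarith
  define d where "d k = 1 / real (Suc k)" for k
  have d: "d k > 0" for k by (simp add: d_def)
  define a where "a k x = min 1 (real (Suc k) * (x * (l - x)))" for k x
  define b where "b k z = sin (pi * z) / max (sin (pi * z)) (d k)" for k z
  define \<gamma> where "\<gamma> k p = max (- M) (min M (g k p)) * a k (fst p) / max (sin (pi * snd p)) (d k)" for k p
  have nz: "max t (d k) \<noteq> 0" for t k using d[of k] by linarith
  have "\<exists>P. real_polynomial_function P \<and>
      (\<forall>p\<in>cbox (0, 0) (l, 1). \<bar>\<gamma> k p - P (trig_coords l p)\<bar> < d k)" for k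
  proof -
    have "continuous_on (cbox (0, 0) (l, 1)) (\<gamma> k)"
      unfolding \<gamma>_def a_def
      by (intro continuous_intros continuous_on_subset[OF g]) (use nz in auto)
    moreover have "\<gamma> k (0, z) = \<gamma> k (l, z)" for z
      by (simp add: \<gamma>_def a_def)
    ultimately show ?thesis
      using trig_polynomial_approximation[OF \<open>l > 0\<close> _ _ d] by metis
  qed
  then obtain P where P: "\<And>k. real_polynomial_function (P k)"
    and approx: "\<And>k p. p \<in> cbox (0, 0) (l, 1) \<Longrightarrow> \<bar>\<gamma> k p - P k (trig_coords l p)\<bar> < d k"
    by metis
  define s where "s k p = P k (trig_coords l p) * sin (pi * snd p)" for k p
  have s: "s k \<in> trig_span l" for k
  proof -
    \<comment> \<open>the generator with frequencies \<open>0\<close> and \<open>1\<close> is \<open>sin (\<pi> z)\<close>\<close>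
    have "(\<lambda>p. cos (of_int 0 * (2 * pi / l * fst p)) * sin (of_int 1 * (pi * snd p))) \<in> trig_span l"
      by (rule trig_span.cos)
    from trig_span_mult_polynomial[OF P this, of k] show ?thesis
      by (rule trig_span_cong) (simp add: s_def)
  qed
  have inside: "p \<in> cbox (0, 0) (l, 1) \<and> 0 < fst p * (l - fst p) \<and> 0 < sin (pi * snd p)" if "p \<in> Omega l" for p
    using that sin_gt_zero[of "pi * snd p"] by (cases p) (auto simp: Omega_def)
  \<comment> \<open>\<open>w k\<close> is \<open>sin (\<pi> z)\<close> times \<open>\<gamma> k\<close>, that is, what \<open>s k\<close> approximates uniformly\<close>
  define w where "w k p = max (- M) (min M (g k p)) * a k (fst p) * b k (snd p)" for k p
  have w_s: "\<bar>w k p - s k p\<bar> \<le> d k" if "p \<in> Omega l" for k p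
  proof -
    have "w k p - s k p = (\<gamma> k p - P k (trig_coords l p)) * sin (pi * snd p)"
      by (simp add: w_def s_def \<gamma>_def b_def left_diff_distrib)
    also have "\<bar>\<dots>\<bar> \<le> d k * 1"
      unfolding abs_mult
      using inside[OF that] approx[of p k] d[of k] by (intro mult_mono) auto
    finally show ?thesis by simp
  qed
  have w_bound: "\<bar>w k p\<bar> \<le> M" if "p \<in> Omega l" for k p
  proof -
    have "\<bar>max (- M) (min M (g k p))\<bar> \<le> M" using M0 by auto
    moreover have "\<bar>a k (fst p)\<bar> \<le> 1"
      using inside[OF that] by (simp add: a_def abs_le_iff min_def)
    moreover have "\<bar>b k (snd p)\<bar> \<le> 1"
      using inside[OF that] d[of k] by (simp add: b_def max_def)
    ultimately have "\<bar>w k p\<bar> \<le> M * 1 * 1"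
      unfolding w_def abs_mult using M0 by (intro mult_mono) auto
    then show ?thesis by simp
  qed
  have d0: "d \<longlonglongrightarrow> 0"
    unfolding d_def using LIMSEQ_inverse_real_of_nat by (simp add: inverse_eq_divide)
  have s_lim: "(\<lambda>k. s k p) \<longlonglongrightarrow> f p" if p: "p \<in> Omega l" "p \<notin> N" for p
  proof -
    have "(\<lambda>k. max (- M) (min M (g k p))) \<longlonglongrightarrow> max (- M) (min M (f p))"
      using lim[OF p(2)] p(1) by (intro tendsto_max tendsto_min tendsto_const) simp
    moreover have "max (- M) (min M (f p)) = f p"
      using M[of p] by auto
    moreover have "(\<lambda>k. a k (fst p)) \<longlonglongrightarrow> 1"
    proof (rule tendsto_eventually)
      show "\<forall>\<^sub>F k in sequentially. a k (fst p) = 1"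
        using eventually_Suc_mult_ge_1[of "fst p * (l - fst p)"] inside[OF p(1)]
        unfolding a_def by (auto elim!: eventually_mono)
    qed
    moreover have "(\<lambda>k. b k (snd p)) \<longlonglongrightarrow> 1"
    proof (rule tendsto_eventually)
      have "\<forall>\<^sub>F k in sequentially. d k < sin (pi * snd p)"
        using order_tendstoD(2)[OF d0] inside[OF p(1)] by blast
      then show "\<forall>\<^sub>F k in sequentially. b k (snd p) = 1"
        using inside[OF p(1)] by (auto simp: b_def max_def elim!: eventually_mono)
    qed
    ultimately have "(\<lambda>k. w k p) \<longlonglongrightarrow> f p * 1 * 1"
      unfolding w_def by (intro tendsto_mult) auto
    moreover have "(\<lambda>k. w k p - s k p) \<longlonglongrightarrow> 0"
      by (rule Lim_null_comparison[OF always_eventually d0]) (use w_s[OF p(1)] in auto)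
    ultimately have "(\<lambda>k. w k p - (w k p - s k p)) \<longlonglongrightarrow> f p * 1 * 1 - 0"
      by (rule tendsto_diff)
    then show ?thesis by simp
  qed
  have "(\<lambda>k. L2_norm (Omega l) (\<lambda>p. f p - s k p)) \<longlonglongrightarrow> 0"
  proof (rule L2_tendsto_dominated[OF f])
    show "s k \<in> borel_measurable (lebesgue_on (Omega l))" for k
      using trig_span_smooth[OF s] smooth_imp_L2 L2_D(1) by blast
    show "(\<lambda>p. 2 * M + 1) \<in> L2 (Omega l)"
      by (intro smooth_imp_L2 smooth_const)
    show "AE p in lebesgue_on (Omega l). (\<lambda>k. s k p) \<longlonglongrightarrow> f p"
      by (rule AE_lebesgue_on_negligible[OF N Omega_sets s_lim])
    show "AE p in lebesgue_on (Omega l). \<bar>f p - s k p\<bar> \<le> 2 * M + 1" for k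
    proof (rule AE_lebesgue_on_negligible[OF N Omega_sets])
      fix p assume "p \<in> Omega l"
      moreover have "d k \<le> 1" by (simp add: d_def)
      ultimately show "\<bar>f p - s k p\<bar> \<le> 2 * M + 1"
        using M[of p] w_s[of p k] w_bound[of p k] by (simp add: abs_le_iff)
    qed
  qed
  then have "\<forall>\<^sub>F k in sequentially. L2_norm (Omega l) (\<lambda>p. f p - s k p) < e"
    using \<open>e > 0\<close> by (rule order_tendstoD(2))
  then obtain k where "L2_norm (Omega l) (\<lambda>p. f p - s k p) < e"
    by (auto simp: eventually_sequentially)
  with s show ?thesis by blast
qed

text \<open>Truncation reduces the claim to bounded functions.\<close>

proposition trig_span_dense:
  assumes "l > 0" and f: "f \<in> L2 (Omega l)" and "e > 0"
  shows "\<exists>s\<in>trig_span l. L2_norm (Omega l) (\<lambda>p. f p - s p) < e"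
proof -
  define h where "h k p = max (- real k) (min (real k) (f p))" for k p
  have fm: "f \<in> borel_measurable (lebesgue_on (Omega l))"
    using f by (rule L2_D)
  have hm: "h k \<in> borel_measurable (lebesgue_on (Omega l))" for k
    unfolding h_def using fm by (intro borel_measurable_max borel_measurable_min borel_measurable_const)
  have hb: "\<bar>h k p\<bar> \<le> real k" for k p by (auto simp: h_def)
  have "(\<lambda>k. L2_norm (Omega l) (\<lambda>p. f p - h k p)) \<longlonglongrightarrow> 0"
  proof (rule L2_tendsto_dominated[OF fm hm])
    have "(\<lambda>p. (\<bar>f p\<bar>)\<^sup>2) = (\<lambda>p. (f p)\<^sup>2)" by simp
    then show "(\<lambda>p. \<bar>f p\<bar>) \<in> L2 (Omega l)"
      using f fm by (auto simp: L2_def)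
    have "(\<lambda>k. h k p) \<longlonglongrightarrow> f p" for p
    proof (rule tendsto_eventually)
      show "\<forall>\<^sub>F k in sequentially. h k p = f p"
        using eventually_ge_at_top[of "nat \<lceil>\<bar>f p\<bar>\<rceil>"]
      proof eventually_elim
        case (elim k)
        then have "\<bar>f p\<bar> \<le> real k" by linarith
        then show ?case by (auto simp: h_def)
      qed
    qed
    then show "AE p in lebesgue_on (Omega l). (\<lambda>k. h k p) \<longlonglongrightarrow> f p" by simp
    have "\<bar>f p - h k p\<bar> \<le> \<bar>f p\<bar>" for k p by (auto simp: h_def)
    then show "AE p in lebesgue_on (Omega l). \<bar>f p - h k p\<bar> \<le> \<bar>f p\<bar>" for k by simp
  qed
  then have "\<forall>\<^sub>F k in sequentially. L2_norm (Omega l) (\<lambda>p. f p - h k p) < e / 2"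
    using \<open>e > 0\<close> by (intro order_tendstoD(2)) auto
  then obtain k where k: "L2_norm (Omega l) (\<lambda>p. f p - h k p) < e / 2"
    by (auto simp: eventually_sequentially)
  obtain s where s: "s \<in> trig_span l" "L2_norm (Omega l) (\<lambda>p. h k p - s p) < e / 2"
    using trig_span_dense_bounded[OF \<open>l > 0\<close> hm hb, of "e / 2" k] \<open>e > 0\<close> by auto
  have "h k \<in> L2 (Omega l)"
    using hm Omega_lmeasurable hb by (rule bounded_imp_L2)
  from L2_norm_triangle[OF f this smooth_imp_L2[OF trig_span_smooth[OF s(1)]]] k s
  have "L2_norm (Omega l) (\<lambda>p. f p - s p) < e" by linarith
  with s(1) show ?thesis by blast
qed

section \<open>Test functions and weak derivatives\<close>

text \<open>With \<open>T\<close> the product of the four flat factors, \<open>1 - exp (- k T)\<close> vanishes where \<open>T\<close> does,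
  takes values in \<open>[0, 1)\<close>, and tends to \<open>1\<close> wherever \<open>T\<close> stays positive. The shift \<open>d\<close> keeps the support
  away from the boundary of the rectangle.\<close>

definition cutoff :: "real \<Rightarrow> nat \<Rightarrow> real \<times> real \<Rightarrow> real" where
  "cutoff l k p = (let d = 1 / real (Suc k) in
     1 - exp (- (real k * (flat 0 (fst p - d) * flat 0 (l - d - fst p)
       * (flat 0 (snd p - d) * flat 0 (1 - d - snd p))))))"

lemma cutoff_smooth: "smooth (cutoff l k)"
proof -
  have "smooth (\<lambda>p. 1 - exp (0 - real k * (flat 0 (fst p - d) * flat 0 (l - d - fst p)
       * (flat 0 (snd p - d) * flat 0 (1 - d - snd p)))))" for d
    by (intro smooth_intros)
  then show ?thesis
    unfolding cutoff_def[abs_def] Let_def by simp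
qed

lemma cutoff_bounds: "0 \<le> cutoff l k p" "cutoff l k p \<le> 1"
  by (simp_all add: cutoff_def Let_def flat_0_nonneg)

lemma cutoff_eq_0:
  assumes "p \<notin> {1 / real (Suc k)..l - 1 / real (Suc k)} \<times> {1 / real (Suc k)..1 - 1 / real (Suc k)}"
  shows "cutoff l k p = 0"
  using assms by (cases p) (auto simp: cutoff_def Let_def flat_0_eq_0_iff not_le)

lemma cutoff_tendsto_1:
  assumes "p \<in> Omega l"
  shows "(\<lambda>k. cutoff l k p) \<longlonglongrightarrow> 1"
proof -
  obtain x z where p: "p = (x, z)" and xz: "0 < x" "x < l" "0 < z" "z < 1"
    using assms by (auto simp: Omega_def)
  define d where "d k = 1 / real (Suc k)" for k
  have d: "d \<longlonglongrightarrow> 0"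
    unfolding d_def using LIMSEQ_inverse_real_of_nat by (simp add: inverse_eq_divide)
  have flat: "(\<lambda>k. flat 0 (u k)) \<longlonglongrightarrow> flat 0 t" if "u \<longlonglongrightarrow> t" for u t
    using DERIV_isCont[OF DERIV_flat] that by (rule isCont_tendsto_compose)
  let ?T = "\<lambda>k. flat 0 (x - d k) * flat 0 (l - d k - x) * (flat 0 (z - d k) * flat 0 (1 - d k - z))"
  let ?c = "flat 0 (x - 0) * flat 0 (l - 0 - x) * (flat 0 (z - 0) * flat 0 (1 - 0 - z))"
  have "?T \<longlonglongrightarrow> ?c"
    by (intro tendsto_mult flat tendsto_diff tendsto_const d)
  moreover have "?c > 0"
    using xz by (simp add: flat_def)
  ultimately have "filterlim (\<lambda>k. ?T k * real k) at_top sequentially"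
    by (rule filterlim_tendsto_pos_mult_at_top) (rule filterlim_real_sequentially)
  then have "filterlim (\<lambda>k. - (?T k * real k)) at_bot sequentially"
    by (simp add: filterlim_uminus_at_bot)
  then have "(\<lambda>k. exp (- (?T k * real k))) \<longlonglongrightarrow> 0"
    by (rule filterlim_compose[OF exp_at_bot])
  then have "(\<lambda>k. 1 - exp (- (?T k * real k))) \<longlonglongrightarrow> 1 - 0"
    by (intro tendsto_diff tendsto_const)
  then show ?thesis
    by (simp add: cutoff_def p d_def Let_def mult.commute[of _ "real _"])
qed

lemma smooth_mult_cutoff_test_fun:
  assumes "smooth s"
  shows "(\<lambda>p. s p * cutoff l k p) \<in> test_fun (Omega l)"
proof -
  define d where "d = 1 / real (Suc k)"
  have pos: "0 < d" by (simp add: d_def)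
  define K where "K = {d..l - d} \<times> {d..1 - d}"
  have K: "compact K" by (simp add: K_def compact_Times)
  have zero: "s p * cutoff l k p = 0" if "p \<notin> K" for p
    using cutoff_eq_0[of p k l] that by (simp add: K_def d_def)
  have "supp (\<lambda>p. s p * cutoff l k p) \<subseteq> K"
    using K zero by (intro supp_subset_closed compact_imp_closed)
  also have "K \<subseteq> Omega l"
  proof
    fix p assume "p \<in> K"
    then show "p \<in> Omega l"
      using pos by (cases p) (auto simp: K_def Omega_def)
  qed
  finally show ?thesis
    unfolding test_fun_def using assms compact_supp_subset[OF K zero]
    by (auto intro: smooth_mult cutoff_smooth)
qed

lemma test_fun_imp_L2: "\<theta> \<in> test_fun (Omega l) \<Longrightarrow> \<theta> \<in> L2 (Omega l)"
  by (simp add: test_fun_def smooth_imp_L2)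

text \<open>Elements of the trigonometric span are smooth and already dense; multiplying them by cutoffs
  makes their support compact at an arbitrarily small cost in \<open>L\<^sup>2\<close>.\<close>

lemma test_fun_dense:
  assumes "l > 0" and f: "f \<in> L2 (Omega l)" and "e > 0"
  shows "\<exists>\<theta>\<in>test_fun (Omega l). L2_norm (Omega l) (\<lambda>p. f p - \<theta> p) < e"
proof -
  obtain s where s: "s \<in> trig_span l" "L2_norm (Omega l) (\<lambda>p. f p - s p) < e / 2"
    using trig_span_dense[OF \<open>l > 0\<close> f, of "e / 2"] \<open>e > 0\<close> by auto
  have sm: "smooth s" using s(1) by (rule trig_span_smooth)
  define \<theta> where "\<theta> k = (\<lambda>p. s p * cutoff l k p)" for k
  have \<theta>: "\<theta> k \<in> test_fun (Omega l)" for k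
    unfolding \<theta>_def using sm by (rule smooth_mult_cutoff_test_fun)
  have "(\<lambda>k. L2_norm (Omega l) (\<lambda>p. s p - \<theta> k p)) \<longlonglongrightarrow> 0"
  proof (rule L2_tendsto_dominated)
    show "s \<in> borel_measurable (lebesgue_on (Omega l))"
      by (rule L2_D(1)[OF smooth_imp_L2[OF sm]])
    show "\<theta> k \<in> borel_measurable (lebesgue_on (Omega l))" for k
      by (rule L2_D(1)[OF test_fun_imp_L2[OF \<theta>]])
    have "(\<lambda>p. (\<bar>s p\<bar>)\<^sup>2) = (\<lambda>p. (s p)\<^sup>2)" by simp
    then show "(\<lambda>p. \<bar>s p\<bar>) \<in> L2 (Omega l)"
      using L2_D[OF smooth_imp_L2[OF sm]] by (auto simp: L2_def)
    show "AE p in lebesgue_on (Omega l). (\<lambda>k. \<theta> k p) \<longlonglongrightarrow> s p"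
    proof (rule AE_I2)
      fix p assume "p \<in> space (lebesgue_on (Omega l))"
      then have "p \<in> Omega l" by simp
      from tendsto_mult[OF tendsto_const cutoff_tendsto_1[OF this], of "s p"]
      show "(\<lambda>k. \<theta> k p) \<longlonglongrightarrow> s p" by (simp add: \<theta>_def)
    qed
    have "\<bar>s p - \<theta> k p\<bar> \<le> \<bar>s p\<bar>" for k p
    proof -
      have "\<bar>s p - \<theta> k p\<bar> = \<bar>s p\<bar> * \<bar>1 - cutoff l k p\<bar>"
        unfolding \<theta>_def abs_mult[symmetric] by (simp add: right_diff_distrib)
      also have "\<dots> \<le> \<bar>s p\<bar> * 1"
        using cutoff_bounds[of l k p] by (intro mult_left_mono) auto
      finally show ?thesis by simp
    qed
    then show "AE p in lebesgue_on (Omega l). \<bar>s p - \<theta> k p\<bar> \<le> \<bar>s p\<bar>" for k by simp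
  qed
  then have "\<forall>\<^sub>F k in sequentially. L2_norm (Omega l) (\<lambda>p. s p - \<theta> k p) < e / 2"
    using \<open>e > 0\<close> by (intro order_tendstoD(2)) auto
  then obtain k where "L2_norm (Omega l) (\<lambda>p. s p - \<theta> k p) < e / 2"
    by (auto simp: eventually_sequentially)
  with L2_norm_triangle[OF f smooth_imp_L2[OF sm] test_fun_imp_L2[OF \<theta>[of k]]] s(2)
  have "L2_norm (Omega l) (\<lambda>p. f p - \<theta> k p) < e" by linarith
  with \<theta> show ?thesis by blast
qed

text \<open>If \<open>\<parallel>g\<parallel> > 0\<close>, density provides \<open>\<theta>\<close> with \<open>\<parallel>g - \<theta>\<parallel> < \<parallel>g\<parallel>\<close>, and orthogonality gives
  \<open>\<parallel>g\<parallel>\<^sup>2 = \<langle>g - \<theta>, g\<rangle> < \<parallel>g\<parallel>\<^sup>2\<close>.\<close>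

lemma L2_orthogonal_to_test_fun_imp_0:
  assumes "l > 0" and g: "g \<in> L2 (Omega l)"
    and orth: "\<And>\<theta>. \<theta> \<in> test_fun (Omega l) \<Longrightarrow> (LINT p|lebesgue_on (Omega l). g p * \<theta> p) = 0"
  shows "AE p in lebesgue_on (Omega l). g p = 0"
proof (rule ccontr)
  assume "\<not> ?thesis"
  then have pos: "L2_norm (Omega l) g > 0"
    using L2_norm_eq_0_iff[OF g] L2_norm_nonneg[of "Omega l" g] by linarith
  then obtain \<theta> where \<theta>: "\<theta> \<in> test_fun (Omega l)"
    and less: "L2_norm (Omega l) (\<lambda>p. g p - \<theta> p) < L2_norm (Omega l) g"
    using test_fun_dense[OF \<open>l > 0\<close> g] by blast
  note \<theta>L2 = test_fun_imp_L2[OF \<theta>]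
  have "(L2_norm (Omega l) g)\<^sup>2 = L2_inner (Omega l) (\<lambda>p. g p - \<theta> p) g"
    using L2_inner_diff[OF g \<theta>L2 g] orth[OF \<theta>]
    by (simp add: L2_norm_power2 L2_inner_def mult.commute)
  also have "\<dots> \<le> L2_norm (Omega l) (\<lambda>p. g p - \<theta> p) * L2_norm (Omega l) g"
    using L2_Cauchy_Schwarz[OF L2_diff[OF g \<theta>L2] g] by linarith
  also have "\<dots> < L2_norm (Omega l) g * L2_norm (Omega l) g"
    using less pos by simp
  finally show False by (simp add: power2_eq_square)
qed

text \<open>Weak derivatives are unique almost everywhere, so the representative chosen by \<open>weak_deriv\<close>
  can be replaced by any function with the defining property.\<close>

lemma weak_deriv_AE_eq:
  assumes "l > 0" and g: "g \<in> L2 (Omega l)" "is_weak_deriv (Omega l) a b f g"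
  shows "weak_deriv (Omega l) a b f \<in> L2 (Omega l)"
    and "AE p in lebesgue_on (Omega l). weak_deriv (Omega l) a b f p = g p"
proof -
  let ?w = "weak_deriv (Omega l) a b f"
  have w: "?w \<in> L2 (Omega l)" "is_weak_deriv (Omega l) a b f ?w"
    using someI[of "\<lambda>g. g \<in> L2 (Omega l) \<and> is_weak_deriv (Omega l) a b f g" g] g
    by (auto simp: weak_deriv_def)
  show "?w \<in> L2 (Omega l)" by (rule w)
  have "AE p in lebesgue_on (Omega l). ?w p - g p = 0"
  proof (rule L2_orthogonal_to_test_fun_imp_0[OF \<open>l > 0\<close> L2_diff[OF w(1) g(1)]])
    fix \<theta> assume \<theta>: "\<theta> \<in> test_fun (Omega l)"
    have "L2_inner (Omega l) ?w \<theta> = L2_inner (Omega l) g \<theta>"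
      using w(2) g(2) \<theta> unfolding is_weak_deriv_def L2_inner_def by simp
    then show "(LINT p|lebesgue_on (Omega l). (?w p - g p) * \<theta> p) = 0"
      using L2_inner_diff[OF w(1) g(1) test_fun_imp_L2[OF \<theta>]] by (simp add: L2_inner_def)
  qed
  then show "AE p in lebesgue_on (Omega l). ?w p = g p" by simp
qed

lemma smooth_imp_sobolev:
  assumes "smooth f" "l > 0"
  shows "f \<in> sobolev r (Omega l)"
  unfolding sobolev_def
  using smooth_imp_L2 smooth_partial_funpow smooth_imp_is_weak_deriv assms by blast

lemma smooth_weak_deriv_AE_eq:
  assumes "smooth f" "l > 0"
  shows "AE p in lebesgue_on (Omega l).
    weak_deriv (Omega l) a b f p = (partial_z ^^ b) ((partial_x ^^ a) f) p"
  using assms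
  by (intro weak_deriv_AE_eq smooth_imp_L2 smooth_partial_funpow smooth_imp_is_weak_deriv)

lemma sobolev_norm_zero:
  assumes "l > 0"
  shows "sobolev_norm r (Omega l) (\<lambda>p. 0) = 0"
proof -
  have "L2_norm (Omega l) (weak_deriv (Omega l) a b (\<lambda>p. 0)) = 0" for a b
  proof -
    have "is_weak_deriv (Omega l) a b (\<lambda>p. 0) (\<lambda>p. 0)"
      by (simp add: is_weak_deriv_def)
    from weak_deriv_AE_eq[OF assms L2_zero this] show ?thesis
      using L2_norm_eq_0_iff by blast
  qed
  then show ?thesis by (simp add: sobolev_norm_def split_def)
qed

section \<open>The eigenfunctions\<close>

text \<open>A smooth function that equals \<open>1\<close> on \<open>[0, l]\<close> and has compact support. The inner terms are zero
  exactly on \<open>[0, l]\<close>, where the outer \<open>flat 0\<close> takes the value \<open>exp (-1)\<close>; for \<open>x \<le> -1\<close> or \<open>x \<ge> l + 1\<close>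
  they add up to at least \<open>1\<close>, because \<open>3 exp (-1) \<ge> 1\<close>, and the outer \<open>flat 0\<close> vanishes.\<close>

definition plateau :: "real \<Rightarrow> real \<Rightarrow> real" where
  "plateau l x = exp 1 * flat 0 (1 - 3 * flat 0 (x - l) - 3 * flat 0 (- x))"

lemma plateau_eq_1: "0 \<le> x \<Longrightarrow> x \<le> l \<Longrightarrow> plateau l x = 1"
  by (simp add: plateau_def flat_def exp_minus)

lemma plateau_eq_0:
  assumes "x \<notin> {-1..l + 1}"
  shows "plateau l x = 0"
proof -
  have "1 \<le> 3 * flat 0 (1::real)"
    using exp_le by (simp add: flat_def exp_minus field_simps)
  moreover have "flat 0 1 \<le> flat 0 (x - l) \<or> flat 0 1 \<le> flat 0 (- x)"
    using assms flat_0_mono[of 1 "x - l"] flat_0_mono[of 1 "- x"] by auto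
  ultimately have "1 - 3 * flat 0 (x - l) - 3 * flat 0 (- x) \<le> 0"
    using flat_0_nonneg[of "x - l"] flat_0_nonneg[of "- x"] by linarith
  then show ?thesis by (simp add: plateau_def flat_0_eq_0_iff)
qed

lemma plateau_smooth: "smooth (\<lambda>p. plateau l (fst p))"
proof -
  have "smooth (\<lambda>p. exp 1 * flat 0 (1 - 3 * flat 0 (fst p - l) - 3 * flat 0 (0 - fst p)))"
    by (intro smooth_intros)
  then show ?thesis by (simp add: plateau_def)
qed

lemma phi_smooth: "smooth (\<lambda>p. phi l i m (fst p))"
  unfolding phi_def
  by (cases "i = 1", simp_all only: simp_thms if_True if_False) (intro smooth_intros)+

lemma chi_smooth: "smooth (\<lambda>p. chi n (snd p))"
  unfolding chi_def by (intro smooth_intros)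

lemma psi_eq: "psi \<beta> l (i, m, n) = (\<lambda>p. phi l i m (fst p) * (chi n (snd p) * exp (- (\<beta> / 2) * snd p)))"
  by (auto simp: psi_def)

lemma psi_smooth: "smooth (psi \<beta> l t)"
proof -
  obtain i m n where t: "t = (i, m, n)" by (cases t) auto
  show ?thesis
    unfolding t psi_eq by (intro smooth_intros phi_smooth chi_smooth)
qed

lemma continuous_on_phi: "continuous_on S (phi l i m)"
  unfolding phi_def
  by (cases "i = 1", simp_all only: simp_thms if_True if_False)
    (intro continuous_on_mult continuous_on_const continuous_on_cos continuous_on_sin continuous_on_id)+

lemma continuous_on_chi: "continuous_on S (chi n)"
  unfolding chi_def by (intro continuous_intros)

lemma chi_0_1: "chi n 0 = 0" "chi n 1 = 0"
  by (simp_all add: chi_def)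

text \<open>The eigenfunction is itself the restriction of an admissible function \<open>v\<close>. In \<open>x\<close> it is
  multiplied by the plateau function, which is \<open>1\<close> on the rectangle. In \<open>z\<close> the factor \<open>chi\<close> is continued
  by its boundary values, and as these are zero, \<open>v\<close> is continuous and vanishes outside the strip.\<close>

lemma psi_C_inf_Omega: "psi \<beta> l (i, m, n) \<in> C_inf_Omega l"
proof -
  define c where "c z = max 0 (min 1 z)" for z :: real
  define v where "v p = plateau l (fst p) *
    (phi l i m (fst p) * (chi n (c (snd p)) * exp (- (\<beta> / 2) * snd p)))" for p
  define g where "g p = plateau l (fst p) * psi \<beta> l (i, m, n) p" for p
  have vg: "v p = g p" if "p \<in> strip" for p
    using that by (auto simp: v_def g_def psi_eq c_def strip_def)
  have "continuous_on UNIV v"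
    unfolding v_def c_def
    by (intro continuous_on_mult smooth_imp_continuous_on[OF plateau_smooth]
        continuous_on_compose2[OF continuous_on_phi[of UNIV]]
        continuous_on_compose2[OF continuous_on_chi[of UNIV]] continuous_intros) auto
  moreover have "smooth g"
    unfolding g_def by (intro smooth_mult plateau_smooth psi_smooth)
  moreover have zero: "v p = 0" if "p \<notin> {-1..l + 1} \<times> {0..1}" for p
  proof (cases "fst p \<in> {-1..l + 1}")
    case True
    then have "c (snd p) = 0 \<or> c (snd p) = 1"
      using that by (cases p) (auto simp: c_def)
    then show ?thesis by (auto simp: v_def chi_0_1)
  qed (simp add: v_def plateau_eq_0)
  have K: "compact ({-1..l + 1} \<times> {0..1::real})" by (simp add: compact_Times)
  have "compact (supp v)"
    using K zero by (rule compact_supp_subset)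
  moreover have "supp v \<subseteq> strip"
    using supp_subset_closed[OF compact_imp_closed[OF K], of v] zero by (auto simp: strip_def)
  ultimately have "v \<in> C0_inf_strip"
    using vg by (auto simp: C0_inf_strip_def)
  moreover have "psi \<beta> l (i, m, n) p = v p" if "p \<in> Omega l" for p
  proof -
    have "p \<in> strip" "plateau l (fst p) = 1"
      using that by (auto simp: Omega_def strip_def plateau_eq_1)
    then show ?thesis by (simp add: vg g_def)
  qed
  ultimately show ?thesis by (auto simp: C_inf_Omega_def)
qed

text \<open>The function \<open>psi\<close> itself serves as the approximation, as it belongs to the set whose closure is taken.\<close>

lemma psi_sobolev0:
  assumes "l > 0"
  shows "psi \<beta> l (i, m, n) \<in> sobolev0 r l"
  unfolding sobolev0_def
proof (intro CollectI conjI allI impI)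
  show "psi \<beta> l (i, m, n) \<in> sobolev r (Omega l)"
    using psi_smooth assms by (rule smooth_imp_sobolev)
  fix e :: real assume "e > 0"
  show "\<exists>u\<in>C_inf_Omega l. sobolev_norm r (Omega l) (\<lambda>p. u p - psi \<beta> l (i, m, n) p) < e"
    by (rule bexI[OF _ psi_C_inf_Omega[of \<beta> l i m n]])
      (use \<open>e > 0\<close> sobolev_norm_zero[OF assms] in simp)
qed

lemma partial_separated:
  assumes "\<And>x. (u has_real_derivative u' x) (at x)" "\<And>z. (v has_real_derivative v' z) (at z)"
  shows "partial_x (\<lambda>p. u (fst p) * v (snd p)) = (\<lambda>p. u' (fst p) * v (snd p))"
    and "partial_z (\<lambda>p. u (fst p) * v (snd p)) = (\<lambda>p. u (fst p) * v' (snd p))"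
  by (auto simp: partial_x_def partial_z_def intro!: ext DERIV_imp_deriv derivative_eq_intros assms)

lemma DERIV_cos_or_sin:
  fixes N c x :: real
  shows "((\<lambda>x. N * (if C then cos (c * x) else sin (c * x))) has_real_derivative
      N * c * (if C then - sin (c * x) else cos (c * x))) (at x)"
    and "((\<lambda>x. N * c * (if C then - sin (c * x) else cos (c * x))) has_real_derivative
      - (c\<^sup>2) * (N * (if C then cos (c * x) else sin (c * x)))) (at x)"
proof -
  have "((\<lambda>x. N * cos (c * x)) has_real_derivative N * c * - sin (c * x)) (at x)"
    "((\<lambda>x. N * sin (c * x)) has_real_derivative N * c * cos (c * x)) (at x)"
    "((\<lambda>x. N * c * - sin (c * x)) has_real_derivative - (c\<^sup>2) * (N * cos (c * x))) (at x)"
    "((\<lambda>x. N * c * cos (c * x)) has_real_derivative - (c\<^sup>2) * (N * sin (c * x))) (at x)"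
    by (auto intro!: derivative_eq_intros simp: power2_eq_square)
  then show "((\<lambda>x. N * (if C then cos (c * x) else sin (c * x))) has_real_derivative
      N * c * (if C then - sin (c * x) else cos (c * x))) (at x)"
    and "((\<lambda>x. N * c * (if C then - sin (c * x) else cos (c * x))) has_real_derivative
      - (c\<^sup>2) * (N * (if C then cos (c * x) else sin (c * x)))) (at x)"
    by (cases C; simp only: if_True if_False)+
qed

text \<open>Separation of variables. The \<open>x\<close>-factor satisfies \<open>u'' = - (2 \<pi> m / l)\<^sup>2 u\<close>. The factor
  \<open>exp (- \<beta> z / 2)\<close> is chosen so that for \<open>v = chi n \<cdot> exp (- \<beta> z / 2)\<close> the cosine terms cancel in
  \<open>v'' + \<beta> v'\<close>, which leaves \<open>- (\<beta>\<^sup>2 / 4 + n\<^sup>2 \<pi>\<^sup>2) v\<close>.\<close>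

lemma psi_vorticity:
  assumes "l > 0"
  shows "AE p in lebesgue_on (Omega l).
    vorticity_op \<beta> l (psi \<beta> l (i, m, n)) p = mu \<beta> l m n * psi \<beta> l (i, m, n) p"
proof -
  define b A where "b = \<beta> / 2" and "A = real n * pi"
  define u1 where "u1 x = (if m = 0 then sqrt (1 / l) else sqrt (2 / l)) * (2 * pi * real m / l) *
      (if i = 1 then - sin (2 * pi * real m / l * x) else cos (2 * pi * real m / l * x))" for x
  define v where "v z = chi n z * exp (- b * z)" for z
  define v1 where "v1 z = sqrt 2 * (A * cos (A * z) - b * sin (A * z)) * exp (- b * z)" for z
  define v2 where "v2 z = sqrt 2 * (b * b * sin (A * z) - A * A * sin (A * z)
    - 2 * b * A * cos (A * z)) * exp (- b * z)" for z
  have u: "(phi l i m has_real_derivative u1 x) (at x)"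
    and u1: "(u1 has_real_derivative - ((2 * pi * real m / l)\<^sup>2) * phi l i m x) (at x)" for x
    unfolding u1_def[abs_def] phi_def[abs_def] by (rule DERIV_cos_or_sin)+
  have v: "(v has_real_derivative v1 z) (at z)" for z
    unfolding v_def[abs_def] v1_def chi_def A_def[symmetric]
    by (auto intro!: derivative_eq_intros simp: algebra_simps)
  have v1: "(v1 has_real_derivative v2 z) (at z)" for z
    unfolding v1_def[abs_def] v2_def
    by (auto intro!: derivative_eq_intros simp: algebra_simps)
  let ?f = "psi \<beta> l (i, m, n)"
  have f: "?f = (\<lambda>p. phi l i m (fst p) * v (snd p))"
    by (simp add: psi_eq v_def b_def)
  have xx: "(partial_x ^^ 2) ?f = (\<lambda>p. - ((2 * pi * real m / l)\<^sup>2) * phi l i m (fst p) * v (snd p))"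
    by (simp only: numeral_2_eq_2 funpow.simps comp_apply id_apply f
        partial_separated(1)[OF u v] partial_separated(1)[OF u1 v])
  have z: "(partial_z ^^ 1) ?f = (\<lambda>p. phi l i m (fst p) * v1 (snd p))"
    by (simp only: One_nat_def funpow.simps comp_apply id_apply f partial_separated(2)[OF u v])
  have zz: "(partial_z ^^ 2) ?f = (\<lambda>p. phi l i m (fst p) * v2 (snd p))"
    by (simp only: numeral_2_eq_2 funpow.simps comp_apply id_apply f
        partial_separated(2)[OF u v] partial_separated(2)[OF u v1])
  have ode: "v2 t + \<beta> * v1 t = - (\<beta>\<^sup>2 / 4 + (real n)\<^sup>2 * pi\<^sup>2) * v t" for t
  proof -
    have "v2 t + (2 * b) * v1 t = - (b * b + A * A) * v t"
      unfolding v_def v1_def v2_def chi_def A_def[symmetric] by (simp add: algebra_simps)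
    then show ?thesis by (simp add: b_def A_def power2_eq_square mult.commute mult.left_commute)
  qed
  note w = smooth_weak_deriv_AE_eq[OF psi_smooth[of \<beta> l "(i, m, n)"] assms]
  show ?thesis
    using w[of 2 0] w[of 0 2] w[of 0 1]
  proof eventually_elim
    case (elim p)
    have "vorticity_op \<beta> l ?f p = - ((2 * pi * real m / l)\<^sup>2) * phi l i m (fst p) * v (snd p)
        + phi l i m (fst p) * (v2 (snd p) + \<beta> * v1 (snd p))"
      using elim xx z zz by (simp add: vorticity_op_def algebra_simps)
    also have "\<dots> = mu \<beta> l m n * ?f p"
      unfolding ode f mu_def by (simp add: algebra_simps power_mult_distrib power_divide)
    finally show ?case .
  qed
qed

section \<open>Orthonormality\<close>

text \<open>The hypothesis says that the interval \<open>[0, L]\<close> consists of half periods, as for \<open>cos (n \<pi> z)\<close> on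
  \<open>[0, 1]\<close>; full periods would not cover the sine basis in \<open>z\<close>.\<close>

lemma has_integral_cos_period:
  fixes c L :: real
  assumes "0 \<le> L" "sin (c * L) = 0"
  shows "((\<lambda>x. cos (c * x)) has_integral (if c = 0 then L else 0)) {0..L}"
proof (cases "c = 0")
  case True
  then show ?thesis using has_integral_const_real[of "1::real" 0 L] assms by simp
next
  case False
  have "((\<lambda>x. cos (c * x)) has_integral sin (c * L) / c - sin (c * 0) / c) {0..L}"
    using assms(1) False
    by (intro fundamental_theorem_of_calculus)
      (auto simp: has_real_derivative_iff_has_vector_derivative[symmetric] intro!: derivative_eq_intros)
  with False assms show ?thesis by simp
qed

lemma has_integral_sin_period:
  fixes c L :: real
  assumes "0 \<le> L" "cos (c * L) = 1"
  shows "((\<lambda>x. sin (c * x)) has_integral 0) {0..L}"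
proof (cases "c = 0")
  case False
  have "((\<lambda>x. sin (c * x)) has_integral - cos (c * L) / c - - cos (c * 0) / c) {0..L}"
    using assms(1) False
    by (intro fundamental_theorem_of_calculus)
      (auto simp: has_real_derivative_iff_has_vector_derivative[symmetric] intro!: derivative_eq_intros)
  with assms show ?thesis by simp
qed simp

lemma has_integral_chi_mult_chi:
  assumes "n \<ge> 1" "h \<ge> 1"
  shows "((\<lambda>z. chi n z * chi h z) has_integral of_bool (n = h)) {0..1}"
proof -
  define a b where "a = real n * pi" and "b = real h * pi"
  have s: "sin ((a - b) * 1) = 0" "sin ((a + b) * 1) = 0"
    by (simp_all add: a_def b_def sin_diff sin_add)
  have ab: "a - b = 0 \<longleftrightarrow> n = h" "a + b \<noteq> 0"
    using assms by (auto simp: a_def b_def distrib_right[symmetric] simp flip: of_nat_add)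
  have "((\<lambda>z. cos ((a - b) * z) - cos ((a + b) * z)) has_integral
      (if a - b = 0 then 1 else 0) - (if a + b = 0 then 1 else 0)) {0..1}"
    by (intro has_integral_diff has_integral_cos_period s) auto
  moreover have "(if a - b = 0 then 1 else 0) - (if a + b = 0 then 1 else 0) = (of_bool (n = h) :: real)"
    using ab by simp
  ultimately have "((\<lambda>z. cos ((a - b) * z) - cos ((a + b) * z)) has_integral of_bool (n = h)) {0..1}"
    by (simp only:)
  moreover have "chi n z * chi h z = cos ((a - b) * z) - cos ((a + b) * z)" for z
  proof -
    have "chi n z * chi h z = 2 * (sin (a * z) * sin (b * z))"
      by (simp add: chi_def a_def b_def)
    then show ?thesis
      by (simp add: sin_times_sin left_diff_distrib distrib_right)
  qed
  ultimately show ?thesis by simp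
qed

lemma has_integral_phi_mult_phi:
  assumes "l > 0" and i: "i \<in> {1, -1}" "(i, m) \<noteq> (-1, 0)" and j: "j \<in> {1, -1}" "(j, k) \<noteq> (-1, 0)"
  shows "((\<lambda>x. phi l i m x * phi l j k x) has_integral of_bool (i = j \<and> m = k)) {0..l}"
proof -
  define N where "N m = (if m = 0 then sqrt (1 / l) else sqrt (2 / l))" for m :: nat
  define a b where "a = 2 * pi * real m / l" and "b = 2 * pi * real k / l"
  have al: "a * l = 2 * pi * of_int (int m)" "b * l = 2 * pi * of_int (int k)"
    using \<open>l > 0\<close> by (simp_all add: a_def b_def)
  have sc: "sin (a * l) = 0" "sin (b * l) = 0" "cos (a * l) = 1" "cos (b * l) = 1"
    unfolding al by (simp_all only: sin_int_2pin cos_int_2pin)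
  have period: "sin ((a - b) * l) = 0" "sin ((a + b) * l) = 0"
    "cos ((a - b) * l) = 1" "cos ((a + b) * l) = 1"
    using sc by (simp_all add: left_diff_distrib distrib_right sin_add sin_diff cos_add cos_diff)
  have l0: "0 \<le> l" using \<open>l > 0\<close> by simp
  have a0: "a - b = 0 \<longleftrightarrow> m = k" "a + b = 0 \<longleftrightarrow> m = 0 \<and> k = 0"
    using \<open>l > 0\<close> by (auto simp: a_def b_def divide_simps add_nonneg_eq_0_iff simp flip: distrib_left of_nat_add)
  have NN: "N m * N m = (if m = 0 then 1 / l else 2 / l)" for m
    using \<open>l > 0\<close> by (simp add: N_def)
  note C = has_integral_cos_period[OF l0 period(1)] has_integral_cos_period[OF l0 period(2)]
  note S = has_integral_sin_period[OF l0 period(3)] has_integral_sin_period[OF l0 period(4)]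
  have phi: "phi l i m x = N m * (if i = 1 then cos (a * x) else sin (a * x))"
    "phi l j k x = N k * (if j = 1 then cos (b * x) else sin (b * x))" for x
    by (simp_all add: phi_def N_def a_def b_def)
  consider "i = 1" "j = 1" | "i = 1" "j = -1" | "i = -1" "j = 1" | "i = -1" "j = -1"
    using i j by auto
  then show ?thesis
  proof cases
    case 1
    have p: "phi l i m x * phi l j k x = (N m * N k / 2) * (cos ((a - b) * x) + cos ((a + b) * x))" for x
      using 1 cos_times_cos[of "a * x" "b * x"] unfolding phi
      by (simp add: left_diff_distrib distrib_right)
    have v: "(N m * N k / 2) * ((if a - b = 0 then l else 0) + (if a + b = 0 then l else 0))
        = of_bool (i = j \<and> m = k)"
      using 1 a0 NN[of m] \<open>l > 0\<close> by (cases "m = k") auto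
    show ?thesis
      unfolding p v[symmetric] by (intro has_integral_mult_right has_integral_add C)
  next
    case 2
    have p: "phi l i m x * phi l j k x = (N m * N k / 2) * (sin ((a + b) * x) - sin ((a - b) * x))" for x
      using 2 cos_times_sin[of "a * x" "b * x"] unfolding phi
      by (simp add: left_diff_distrib distrib_right)
    have v: "(N m * N k / 2) * (0 - 0) = of_bool (i = j \<and> m = k)"
      using 2 by simp
    show ?thesis
      unfolding p v[symmetric] by (intro has_integral_mult_right has_integral_diff S)
  next
    case 3
    have p: "phi l i m x * phi l j k x = (N m * N k / 2) * (sin ((a + b) * x) + sin ((a - b) * x))" for x
      using 3 sin_times_cos[of "a * x" "b * x"] unfolding phi
      by (simp add: left_diff_distrib distrib_right)
    have v: "(N m * N k / 2) * (0 + 0) = of_bool (i = j \<and> m = k)"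
      using 3 by simp
    show ?thesis
      unfolding p v[symmetric] by (intro has_integral_mult_right has_integral_add S)
  next
    case 4
    have p: "phi l i m x * phi l j k x = (N m * N k / 2) * (cos ((a - b) * x) - cos ((a + b) * x))" for x
      using 4 sin_times_sin[of "a * x" "b * x"] unfolding phi
      by (simp add: left_diff_distrib distrib_right)
    have v: "(N m * N k / 2) * ((if a - b = 0 then l else 0) - (if a + b = 0 then l else 0))
        = of_bool (i = j \<and> m = k)"
      using 4 i a0 NN[of m] \<open>l > 0\<close> by (cases "m = k") auto
    show ?thesis
      unfolding p v[symmetric] by (intro has_integral_mult_right has_integral_diff C)
  qed
qed

text \<open>The eigenfunctions without the factor \<open>exp (- \<beta> z / 2)\<close>: an orthonormal system for the
  unweighted inner product, to which everything about \<open>psi\<close> is reduced.\<close>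

definition trig_basis :: "real \<Rightarrow> int \<times> nat \<times> nat \<Rightarrow> real \<times> real \<Rightarrow> real" where
  "trig_basis l = (\<lambda>(i, m, n) p. phi l i m (fst p) * chi n (snd p))"

lemma trig_basis_smooth: "smooth (trig_basis l t)"
  unfolding trig_basis_def by (cases t) (auto intro!: smooth_mult phi_smooth chi_smooth)

lemma trig_basis_L2: "trig_basis l t \<in> L2 (Omega l)"
  by (rule smooth_imp_L2[OF trig_basis_smooth])

lemma trig_basis_orthonormal:
  assumes "l > 0" "s \<in> index_set" "t \<in> index_set"
  shows "L2_inner (Omega l) (trig_basis l s) (trig_basis l t) = of_bool (s = t)"
proof -
  obtain i m n j k h where s: "s = (i, m, n)" and t: "t = (j, k, h)"
    by (cases s; cases t) auto
  have "continuous_on (cbox (0, 0) (l, 1)) (\<lambda>p. trig_basis l s p * trig_basis l t p)"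
    by (intro smooth_imp_continuous_on smooth_mult trig_basis_smooth)
  then have "L2_inner (Omega l) (trig_basis l s) (trig_basis l t)
      = integral {0..l} (\<lambda>x. integral {0..1} (\<lambda>z. trig_basis l s (x, z) * trig_basis l t (x, z)))"
    unfolding L2_inner_def by (rule LINT_Omega)
  also have "\<dots> = integral {0..l} (\<lambda>x. phi l i m x * phi l j k x * of_bool (n = h))"
  proof -
    have "integral {0..1} (\<lambda>z. trig_basis l s (x, z) * trig_basis l t (x, z))
        = phi l i m x * phi l j k x * of_bool (n = h)" for x
    proof -
      have "((\<lambda>z. phi l i m x * phi l j k x * (chi n z * chi h z)) has_integral
          phi l i m x * phi l j k x * of_bool (n = h)) {0..1}"
        using assms by (intro has_integral_mult_right has_integral_chi_mult_chi)
          (auto simp: s t index_set_def)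
      then show ?thesis
        by (simp add: s t trig_basis_def integral_unique mult.commute mult.left_commute)
    qed
    then show ?thesis by simp
  qed
  also have "\<dots> = of_bool (i = j \<and> m = k) * of_bool (n = h)"
    using assms
    by (intro integral_unique has_integral_mult_left has_integral_phi_mult_phi)
      (auto simp: s t index_set_def)
  also have "\<dots> = of_bool (s = t)" by (simp add: s t)
  finally show ?thesis .
qed

lemma psi_eq_trig_basis: "psi \<beta> l t p = exp (- (\<beta> / 2) * snd p) * trig_basis l t p"
  by (cases t) (simp add: psi_eq trig_basis_def)

text \<open>The weight \<open>exp (\<beta> z)\<close> cancels the two factors \<open>exp (- \<beta> z / 2)\<close>, so weighted orthonormality of
  \<open>psi\<close> is orthonormality of \<open>trig_basis\<close>.\<close>

lemma psi_weighted_product: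
  "psi \<beta> l s p * exp (\<beta> * snd p) * psi \<beta> l t p = trig_basis l s p * trig_basis l t p"
proof -
  have "exp (- (\<beta> / 2) * snd p) * exp (\<beta> * snd p) * exp (- (\<beta> / 2) * snd p) = 1"
    unfolding exp_add[symmetric] by (simp add: field_simps)
  then show ?thesis
    unfolding psi_eq_trig_basis by (metis mult.assoc mult.commute mult_1)
qed

section \<open>Expansion in an orthonormal system\<close>

text \<open>By Pythagoras, \<open>\<parallel>f - \<Sum> a t e t\<parallel>\<^sup>2 = \<parallel>f\<parallel>\<^sup>2 - \<Sum> \<langle>f, e t\<rangle>\<^sup>2 + \<Sum> (a t - \<langle>f, e t\<rangle>)\<^sup>2\<close>, and the right-hand
  side is smallest when the last sum vanishes.\<close>

lemma orthonormal_best_approximation: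
  assumes f: "f \<in> L2 S" and e: "\<And>t. t \<in> I \<Longrightarrow> e t \<in> L2 S"
    and orth: "\<And>s t. s \<in> I \<Longrightarrow> t \<in> I \<Longrightarrow> L2_inner S (e s) (e t) = of_bool (s = t)"
    and F: "finite F" "F \<subseteq> I"
  shows "L2_norm S (\<lambda>p. f p - (\<Sum>t\<in>F. L2_inner S f (e t) * e t p))
    \<le> L2_norm S (\<lambda>p. f p - (\<Sum>t\<in>F. a t * e t p))"
proof -
  have key: "(L2_norm S (\<lambda>p. f p - (\<Sum>t\<in>F. a t * e t p)))\<^sup>2
      = L2_inner S f f - (\<Sum>t\<in>F. (L2_inner S f (e t))\<^sup>2) + (\<Sum>t\<in>F. (a t - L2_inner S f (e t))\<^sup>2)" for a
  proof -
    define g where "g = (\<lambda>p. \<Sum>t\<in>F. a t * e t p)"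
    have ae: "(\<lambda>p. a t * e t p) \<in> L2 S" if "t \<in> F" for t
      using e F that by (auto intro: L2_scale)
    have g: "g \<in> L2 S"
      unfolding g_def using ae by (rule L2_sum)
    have gh: "L2_inner S g h = (\<Sum>t\<in>F. a t * L2_inner S (e t) h)" if "h \<in> L2 S" for h
      unfolding g_def L2_inner_scale[symmetric] by (rule L2_inner_sum) (use ae that in auto)
    have ge: "L2_inner S g (e t) = a t" if "t \<in> F" for t
    proof -
      have "t \<in> I" using that F by blast
      then have "L2_inner S g (e t) = (\<Sum>s\<in>F. a s * L2_inner S (e s) (e t))"
        by (intro gh e)
      also have "\<dots> = (\<Sum>s\<in>F. if s = t then a s else 0)"
        using orth[OF _ \<open>t \<in> I\<close>] F by (intro sum.cong) auto
      finally show ?thesis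
        using F(1) that by simp
    qed
    have gf: "L2_inner S g f = (\<Sum>t\<in>F. a t * L2_inner S f (e t))"
      using gh[OF f] by (simp add: L2_inner_commute[of S f])
    have eg: "L2_inner S (e t) g = a t" if "t \<in> F" for t
      using ge[OF that] by (subst L2_inner_commute)
    have gg: "L2_inner S g g = (\<Sum>t\<in>F. a t * a t)"
      unfolding gh[OF g] by (rule sum.cong) (simp_all add: eg)
    have "(L2_norm S (\<lambda>p. f p - g p))\<^sup>2
        = L2_inner S f f - L2_inner S f g - (L2_inner S g f - L2_inner S g g)"
      unfolding L2_norm_power2 L2_inner_diff[OF f g L2_diff[OF f g]]
        L2_inner_diff_right[OF f g f] L2_inner_diff_right[OF f g g] ..
    also have "\<dots> = L2_inner S f f - L2_inner S g f - (L2_inner S g f - L2_inner S g g)"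
      by (simp only: L2_inner_commute[of S f g])
    also have "\<dots> = L2_inner S f f - (\<Sum>t\<in>F. 2 * (a t * L2_inner S f (e t)) - a t * a t)"
      unfolding gf gg by (simp add: sum_subtractf sum_distrib_left[symmetric])
    also have "\<dots> = L2_inner S f f - (\<Sum>t\<in>F. (L2_inner S f (e t))\<^sup>2 - (a t - L2_inner S f (e t))\<^sup>2)"
      by (simp add: power2_eq_square algebra_simps)
    finally show ?thesis
      by (simp add: g_def sum_subtractf)
  qed
  have "(L2_norm S (\<lambda>p. f p - (\<Sum>t\<in>F. L2_inner S f (e t) * e t p)))\<^sup>2
    \<le> (L2_norm S (\<lambda>p. f p - (\<Sum>t\<in>F. a t * e t p)))\<^sup>2"
    unfolding key by (simp add: sum_nonneg)
  then show ?thesis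
    by (rule power2_le_imp_le) (rule L2_norm_nonneg)
qed

text \<open>A finite combination close to \<open>f\<close>, padded with zero coefficients, is no better than the Fourier
  sum over any larger finite index set, which is convergence along the net of finite subsets.\<close>

lemma orthonormal_dense_imp_L2_has_sum:
  assumes f: "f \<in> L2 S" and e: "\<And>t. t \<in> I \<Longrightarrow> e t \<in> L2 S"
    and orth: "\<And>s t. s \<in> I \<Longrightarrow> t \<in> I \<Longrightarrow> L2_inner S (e s) (e t) = of_bool (s = t)"
    and dense: "\<And>\<epsilon>. \<epsilon> > 0 \<Longrightarrow> \<exists>F a. finite F \<and> F \<subseteq> I \<and> L2_norm S (\<lambda>p. f p - (\<Sum>t\<in>F. a t * e t p)) < \<epsilon>"
  shows "L2_has_sum S (\<lambda>t p. L2_inner S f (e t) * e t p) f I"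
  unfolding L2_has_sum_def
proof (rule tendstoI)
  fix \<epsilon> :: real assume "\<epsilon> > 0"
  then obtain F a where F: "finite F" "F \<subseteq> I"
    and less: "L2_norm S (\<lambda>p. f p - (\<Sum>t\<in>F. a t * e t p)) < \<epsilon>"
    using dense by blast
  have "dist (L2_norm S (\<lambda>p. f p - (\<Sum>t\<in>G. L2_inner S f (e t) * e t p))) 0 < \<epsilon>"
    if G: "finite G" "F \<subseteq> G" "G \<subseteq> I" for G
  proof -
    have "(\<Sum>t\<in>G. (if t \<in> F then a t else 0) * e t p) = (\<Sum>t\<in>F. a t * e t p)" for p
      using G by (intro sum.mono_neutral_cong_right) auto
    then show ?thesis
      using orthonormal_best_approximation[OF f e orth G(1,3), of "\<lambda>t. if t \<in> F then a t else 0"] less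
      by (simp add: L2_norm_nonneg)
  qed
  then show "\<forall>\<^sub>F G in finite_subsets_at_top I.
      dist (L2_norm S (\<lambda>p. f p - (\<Sum>t\<in>G. L2_inner S f (e t) * e t p))) 0 < \<epsilon>"
    unfolding eventually_finite_subsets_at_top using F by blast
qed

text \<open>The inner product with \<open>e t\<close> is continuous, and on every finite partial sum whose index set
  contains \<open>t\<close> it equals \<open>A t\<close>.\<close>

lemma L2_has_sum_orthonormal_coefficient:
  assumes f: "f \<in> L2 S" and e: "\<And>t. t \<in> I \<Longrightarrow> e t \<in> L2 S"
    and orth: "\<And>s t. s \<in> I \<Longrightarrow> t \<in> I \<Longrightarrow> L2_inner S (e s) (e t) = of_bool (s = t)"
    and sum: "L2_has_sum S (\<lambda>t p. A t * e t p) f I" and t: "t \<in> I"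
  shows "A t = L2_inner S f (e t)"
proof -
  have "\<forall>\<^sub>F F in finite_subsets_at_top I.
      norm (L2_inner S f (e t) - A t) \<le> L2_norm S (\<lambda>p. f p - (\<Sum>t\<in>F. A t * e t p))"
    unfolding eventually_finite_subsets_at_top
  proof (intro exI conjI allI impI)
    show "finite {t}" "{t} \<subseteq> I" using t by auto
    fix F assume F: "finite F \<and> {t} \<subseteq> F \<and> F \<subseteq> I"
    define g where "g = (\<lambda>p. \<Sum>t\<in>F. A t * e t p)"
    have Ae: "(\<lambda>p. A s * e s p) \<in> L2 S" if "s \<in> F" for s
      using e F that by (auto intro: L2_scale)
    have g: "g \<in> L2 S"
      unfolding g_def using Ae by (rule L2_sum)
    have "L2_inner S g (e t) = (\<Sum>s\<in>F. A s * L2_inner S (e s) (e t))"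
      unfolding g_def L2_inner_scale[symmetric] by (rule L2_inner_sum) (use Ae e[OF t] in auto)
    also have "\<dots> = (\<Sum>s\<in>F. if s = t then A s else 0)"
      using orth[OF _ t] F by (intro sum.cong) auto
    also have "\<dots> = A t"
      using F by simp
    finally have "L2_inner S f (e t) - A t = L2_inner S (\<lambda>p. f p - g p) (e t)"
      by (simp add: L2_inner_diff[OF f g e[OF t]])
    also have "\<bar>\<dots>\<bar> \<le> L2_norm S (\<lambda>p. f p - g p) * L2_norm S (e t)"
      by (rule L2_Cauchy_Schwarz[OF L2_diff[OF f g] e[OF t]])
    also have "L2_norm S (e t) = 1"
      using L2_norm_power2[of S "e t"] orth[OF t t] L2_norm_nonneg[of S "e t"]
      by (simp add: power2_eq_1_iff)
    finally show "norm (L2_inner S f (e t) - A t) \<le> L2_norm S (\<lambda>p. f p - (\<Sum>t\<in>F. A t * e t p))"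
      by (simp add: g_def)
  qed
  then have "((\<lambda>F. L2_inner S f (e t) - A t) \<longlongrightarrow> 0) (finite_subsets_at_top I)"
    using sum unfolding L2_has_sum_def by (rule Lim_null_comparison)
  then have "L2_inner S f (e t) - A t = 0"
    by (simp add: tendsto_const_iff)
  then show ?thesis by simp
qed

lemma L2_mult_bounded:
  assumes f: "f \<in> L2 S" and b: "b \<in> borel_measurable (lebesgue_on S)"
    and B: "\<And>p. p \<in> S \<Longrightarrow> \<bar>b p\<bar> \<le> B" "0 \<le> B"
  shows "(\<lambda>p. b p * f p) \<in> L2 S" and "L2_norm S (\<lambda>p. b p * f p) \<le> B * L2_norm S f"
proof -
  have m: "(\<lambda>p. b p * f p) \<in> borel_measurable (lebesgue_on S)"
    using b L2_D(1)[OF f] by (rule borel_measurable_times)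
  have le: "(b p * f p)\<^sup>2 \<le> B\<^sup>2 * (f p)\<^sup>2" if "p \<in> S" for p
  proof -
    have "(b p)\<^sup>2 \<le> B\<^sup>2"
      using B(1)[OF that] power_mono[of "\<bar>b p\<bar>" B 2] by simp
    then show ?thesis
      unfolding power_mult_distrib by (rule mult_right_mono) simp
  qed
  have i: "integrable (lebesgue_on S) (\<lambda>p. B\<^sup>2 * (f p)\<^sup>2)"
    using L2_D(2)[OF f] by (rule integrable_mult_right)
  have j: "integrable (lebesgue_on S) (\<lambda>p. (b p * f p)\<^sup>2)"
  proof (rule Bochner_Integration.integrable_bound[OF i])
    show "(\<lambda>p. (b p * f p)\<^sup>2) \<in> borel_measurable (lebesgue_on S)"
      using m by (rule borel_measurable_power)
    show "AE p in lebesgue_on S. norm ((b p * f p)\<^sup>2) \<le> norm (B\<^sup>2 * (f p)\<^sup>2)"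
      using le by (intro AE_I2) simp
  qed
  show "(\<lambda>p. b p * f p) \<in> L2 S"
    using m j by (simp add: L2_def)
  have "(LINT p|lebesgue_on S. (b p * f p)\<^sup>2) \<le> (LINT p|lebesgue_on S. B\<^sup>2 * (f p)\<^sup>2)"
    by (rule integral_mono[OF j i]) (use le in simp)
  also have "\<dots> = B\<^sup>2 * (LINT p|lebesgue_on S. (f p)\<^sup>2)"
    by simp
  finally have "L2_norm S (\<lambda>p. b p * f p) \<le> sqrt (B\<^sup>2 * (LINT p|lebesgue_on S. (f p)\<^sup>2))"
    unfolding L2_norm_def by (rule real_sqrt_le_mono)
  then show "L2_norm S (\<lambda>p. b p * f p) \<le> B * L2_norm S f"
    using B(2) by (simp add: L2_norm_def real_sqrt_mult)
qed

lemma L2_has_sum_mult_bounded: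
  assumes f: "f \<in> L2 S" and e: "\<And>t. t \<in> I \<Longrightarrow> e t \<in> L2 S"
    and b: "b \<in> borel_measurable (lebesgue_on S)" "\<And>p. p \<in> S \<Longrightarrow> \<bar>b p\<bar> \<le> B" "0 \<le> B"
    and sum: "L2_has_sum S (\<lambda>t p. A t * e t p) f I"
  shows "L2_has_sum S (\<lambda>t p. A t * (b p * e t p)) (\<lambda>p. b p * f p) I"
proof -
  have "\<forall>\<^sub>F F in finite_subsets_at_top I. norm (L2_norm S (\<lambda>p. b p * f p - (\<Sum>t\<in>F. A t * (b p * e t p))))
      \<le> B * L2_norm S (\<lambda>p. f p - (\<Sum>t\<in>F. A t * e t p))"
    unfolding eventually_finite_subsets_at_top
  proof (intro exI conjI allI impI)
    show "finite {}" "{} \<subseteq> I" by auto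
    fix F assume F: "finite F \<and> {} \<subseteq> F \<and> F \<subseteq> I"
    have "(\<lambda>p. f p - (\<Sum>t\<in>F. A t * e t p)) \<in> L2 S"
      by (intro L2_diff L2_sum L2_scale f e) (use F in auto)
    moreover have "b p * f p - (\<Sum>t\<in>F. A t * (b p * e t p)) = b p * (f p - (\<Sum>t\<in>F. A t * e t p))" for p
      by (simp add: right_diff_distrib sum_distrib_left mult.left_commute)
    ultimately show "norm (L2_norm S (\<lambda>p. b p * f p - (\<Sum>t\<in>F. A t * (b p * e t p))))
        \<le> B * L2_norm S (\<lambda>p. f p - (\<Sum>t\<in>F. A t * e t p))"
      using L2_mult_bounded(2)[OF _ b] by (simp add: L2_norm_nonneg)
  qed
  moreover have "((\<lambda>F. B * L2_norm S (\<lambda>p. f p - (\<Sum>t\<in>F. A t * e t p))) \<longlongrightarrow> 0) (finite_subsets_at_top I)"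
    using tendsto_mult_left[OF sum[unfolded L2_has_sum_def], of B] by simp
  ultimately show ?thesis
    unfolding L2_has_sum_def by (rule Lim_null_comparison)
qed

section \<open>Completeness of the eigenfunctions\<close>

text \<open>A generator with a negative frequency differs at most in sign from the one with the absolute value of the
  frequency. The generators without a counterpart in \<open>index_set\<close> contain a sine of frequency zero and
  vanish.\<close>

lemma trig_span_imp_combination:
  assumes "l > 0" and "s \<in> trig_span l"
  shows "\<exists>F a. finite F \<and> F \<subseteq> index_set \<and> s = (\<lambda>p. \<Sum>t\<in>F. a t * trig_basis l t p)"
  using assms(2)
proof induction
  case (cos m n)
  show ?case
  proof (cases "n = 0")
    case True
    then show ?thesis by (intro exI[of _ "{}"]) simp
  next
    case False
    define c where "c = (if m = 0 then sqrt (1 / l) else sqrt (2 / l)) * sqrt 2"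
    have c: "c \<noteq> 0" using \<open>l > 0\<close> by (simp add: c_def)
    let ?t = "(1, nat \<bar>m\<bar>, nat \<bar>n\<bar>) :: int \<times> nat \<times> nat"
    have basis: "trig_basis l ?t p
        = c * (cos (\<bar>of_int m\<bar> * (2 * pi / l * fst p)) * sin (\<bar>of_int n\<bar> * (pi * snd p)))" for p
      by (simp add: trig_basis_def phi_def chi_def c_def mult_ac)
    have "cos (of_int m * X) * sin (of_int n * Z)
        = (of_int (sgn n) / c) * (c * (cos (\<bar>of_int m\<bar> * X) * sin (\<bar>of_int n\<bar> * Z)))" for X Z :: real
      using False c by (simp add: abs_if sgn_if)
    from this[of "2 * pi / l * fst p" "pi * snd p" for p]
    have "cos (of_int m * (2 * pi / l * fst p)) * sin (of_int n * (pi * snd p))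
        = (of_int (sgn n) / c) * trig_basis l ?t p" for p
      unfolding basis .
    then show ?thesis
      using False by (intro exI[of _ "{?t}"] exI[of _ "\<lambda>_. of_int (sgn n) / c"])
        (auto simp: index_set_def)
  qed
next
  case (sin m n)
  show ?case
  proof (cases "m = 0 \<or> n = 0")
    case True
    then show ?thesis by (intro exI[of _ "{}"]) auto
  next
    case False
    define c where "c = sqrt (2 / l) * sqrt 2"
    have c: "c \<noteq> 0" using \<open>l > 0\<close> by (simp add: c_def)
    let ?t = "(-1, nat \<bar>m\<bar>, nat \<bar>n\<bar>) :: int \<times> nat \<times> nat"
    have basis: "trig_basis l ?t p
        = c * (sin (\<bar>of_int m\<bar> * (2 * pi / l * fst p)) * sin (\<bar>of_int n\<bar> * (pi * snd p)))" for p
      using False by (simp add: trig_basis_def phi_def chi_def c_def mult_ac)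
    have "sin (of_int m * X) * sin (of_int n * Z) = (of_int (sgn m) * of_int (sgn n) / c)
        * (c * (sin (\<bar>of_int m\<bar> * X) * sin (\<bar>of_int n\<bar> * Z)))" for X Z :: real
      using False c by (simp add: abs_if sgn_if)
    from this[of "2 * pi / l * fst p" "pi * snd p" for p]
    have "sin (of_int m * (2 * pi / l * fst p)) * sin (of_int n * (pi * snd p))
        = (of_int (sgn m) * of_int (sgn n) / c) * trig_basis l ?t p" for p
      unfolding basis .
    then show ?thesis
      using False by (intro exI[of _ "{?t}"] exI[of _ "\<lambda>_. of_int (sgn m) * of_int (sgn n) / c"])
        (auto simp: index_set_def)
  qed
next
  case (add s t)
  obtain F a where F: "finite F" "F \<subseteq> index_set" "s = (\<lambda>p. \<Sum>t\<in>F. a t * trig_basis l t p)"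
    using add.IH(1) by blast
  obtain G b where G: "finite G" "G \<subseteq> index_set" "t = (\<lambda>p. \<Sum>t\<in>G. b t * trig_basis l t p)"
    using add.IH(2) by blast
  let ?c = "\<lambda>t. (if t \<in> F then a t else 0) + (if t \<in> G then b t else 0)"
  have "(\<Sum>t\<in>F \<union> G. ?c t * trig_basis l t p) = s p + t p" for p
  proof -
    have "(\<Sum>t\<in>F \<union> G. (if t \<in> F then a t else 0) * trig_basis l t p) = s p"
      unfolding F(3) using F(1) G(1) by (intro sum.mono_neutral_cong_right) auto
    moreover have "(\<Sum>t\<in>F \<union> G. (if t \<in> G then b t else 0) * trig_basis l t p) = t p"
      unfolding G(3) using F(1) G(1) by (intro sum.mono_neutral_cong_right) auto
    ultimately show ?thesis
      by (simp only: distrib_right sum.distrib)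
  qed
  then have "(\<lambda>p. s p + t p) = (\<lambda>p. \<Sum>t\<in>F \<union> G. ?c t * trig_basis l t p)" by simp
  moreover have "finite (F \<union> G)" "F \<union> G \<subseteq> index_set" using F G by auto
  ultimately show ?case by (intro exI[of _ "F \<union> G"] exI[of _ ?c] conjI)
next
  case (scale s c)
  then obtain F a where F: "finite F" "F \<subseteq> index_set" "s = (\<lambda>p. \<Sum>t\<in>F. a t * trig_basis l t p)"
    by blast
  have "(\<lambda>p. c * s p) = (\<lambda>p. \<Sum>t\<in>F. (c * a t) * trig_basis l t p)"
    unfolding F(3) by (simp add: sum_distrib_left mult.assoc)
  with F(1,2) show ?case by (intro exI[of _ F] exI[of _ "\<lambda>t. c * a t"] conjI)
qed

lemma trig_basis_L2_has_sum:
  assumes "l > 0" and f: "f \<in> L2 (Omega l)"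
  shows "L2_has_sum (Omega l) (\<lambda>t p. L2_inner (Omega l) f (trig_basis l t) * trig_basis l t p) f index_set"
proof (rule orthonormal_dense_imp_L2_has_sum[OF f trig_basis_L2 trig_basis_orthonormal[OF \<open>l > 0\<close>]])
  fix \<epsilon> :: real assume "\<epsilon> > 0"
  then obtain s where "s \<in> trig_span l" "L2_norm (Omega l) (\<lambda>p. f p - s p) < \<epsilon>"
    using trig_span_dense[OF \<open>l > 0\<close> f] by blast
  then show "\<exists>F a. finite F \<and> F \<subseteq> index_set \<and>
      L2_norm (Omega l) (\<lambda>p. f p - (\<Sum>t\<in>F. a t * trig_basis l t p)) < \<epsilon>"
    using trig_span_imp_combination[OF \<open>l > 0\<close>] by blast
qed

text \<open>Multiplication by \<open>exp (\<beta> z / 2)\<close> and its inverse are bounded on the rectangle, so they carry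
  expansions of \<open>f\<close> in \<open>psi\<close> to expansions of \<open>h = exp (\<beta> z / 2) f\<close> in the orthonormal system
  \<open>trig_basis\<close> and back. Existence and uniqueness are thus those for \<open>h\<close>.\<close>

proposition psi_complete_basis:
  assumes "\<beta> > 0" "l > 0"
  shows "complete_basis (Omega l) (psi \<beta> l) index_set"
  unfolding complete_basis_def
proof (intro conjI ballI)
  show "psi \<beta> l t \<in> L2 (Omega l)" for t
    by (rule smooth_imp_L2[OF psi_smooth])
  fix f assume f: "f \<in> L2 (Omega l)"
  define up where "up p = exp (\<beta> / 2 * snd p)" for p :: "real \<times> real"
  define down where "down p = exp (- (\<beta> / 2) * snd p)" for p :: "real \<times> real"
  have up: "up \<in> borel_measurable (lebesgue_on (Omega l))"
    unfolding up_def[abs_def] by (rule L2_D(1)[OF smooth_imp_L2]) (intro smooth_intros)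
  have down: "down \<in> borel_measurable (lebesgue_on (Omega l))"
    unfolding down_def[abs_def] by (rule L2_D(1)[OF smooth_imp_L2]) (intro smooth_intros)
  have up_bound: "\<bar>up p\<bar> \<le> exp (\<beta> / 2)" if "p \<in> Omega l" for p
    using that \<open>\<beta> > 0\<close> by (cases p) (auto simp: up_def Omega_def)
  have down_bound: "\<bar>down p\<bar> \<le> 1" if "p \<in> Omega l" for p
    using that \<open>\<beta> > 0\<close> by (cases p) (auto simp: down_def Omega_def)
  have up_down: "up p * (down p * y) = y" "down p * (up p * y) = y" for p y
    by (simp_all add: up_def down_def mult.assoc[symmetric] exp_add[symmetric])
  have psi: "psi \<beta> l t = (\<lambda>p. down p * trig_basis l t p)" for t
    by (auto simp: psi_eq_trig_basis down_def)
  define h where "h p = up p * f p" for p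
  have h: "h \<in> L2 (Omega l)"
    unfolding h_def[abs_def] using f up up_bound by (rule L2_mult_bounded) simp_all
  show "\<exists>!A. A \<in> index_set \<rightarrow>\<^sub>E UNIV \<and> L2_has_sum (Omega l) (\<lambda>t p. A t * psi \<beta> l t p) f index_set"
  proof (rule ex1I)
    let ?A = "restrict (\<lambda>t. L2_inner (Omega l) h (trig_basis l t)) index_set"
    have "L2_has_sum (Omega l) (\<lambda>t p. L2_inner (Omega l) h (trig_basis l t) * (down p * trig_basis l t p))
        (\<lambda>p. down p * h p) index_set"
      using h trig_basis_L2 down down_bound _ trig_basis_L2_has_sum[OF \<open>l > 0\<close> h]
      by (rule L2_has_sum_mult_bounded) simp_all
    then have *: "L2_has_sum (Omega l) (\<lambda>t p. L2_inner (Omega l) h (trig_basis l t) * psi \<beta> l t p) f index_set"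
      by (simp add: psi h_def up_down)
    have "L2_has_sum (Omega l) (\<lambda>t p. ?A t * psi \<beta> l t p) f index_set"
      using * unfolding L2_has_sum_def
    proof (rule Lim_transform_eventually)
      show "\<forall>\<^sub>F F in finite_subsets_at_top index_set.
          L2_norm (Omega l) (\<lambda>p. f p - (\<Sum>t\<in>F. L2_inner (Omega l) h (trig_basis l t) * psi \<beta> l t p))
          = L2_norm (Omega l) (\<lambda>p. f p - (\<Sum>t\<in>F. ?A t * psi \<beta> l t p))"
        unfolding eventually_finite_subsets_at_top
      proof (intro exI[of _ "{}"] conjI allI impI)
        fix F assume F: "finite F \<and> {} \<subseteq> F \<and> F \<subseteq> index_set"
        have "(\<Sum>t\<in>F. L2_inner (Omega l) h (trig_basis l t) * psi \<beta> l t p)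
            = (\<Sum>t\<in>F. ?A t * psi \<beta> l t p)" for p
          by (rule sum.cong) (use F in auto)
        then show "L2_norm (Omega l) (\<lambda>p. f p - (\<Sum>t\<in>F. L2_inner (Omega l) h (trig_basis l t) * psi \<beta> l t p))
          = L2_norm (Omega l) (\<lambda>p. f p - (\<Sum>t\<in>F. ?A t * psi \<beta> l t p))" by simp
      qed auto
    qed
    then show "?A \<in> index_set \<rightarrow>\<^sub>E UNIV \<and> L2_has_sum (Omega l) (\<lambda>t p. ?A t * psi \<beta> l t p) f index_set"
      by auto
  next
    fix A assume A: "A \<in> index_set \<rightarrow>\<^sub>E UNIV \<and> L2_has_sum (Omega l) (\<lambda>t p. A t * psi \<beta> l t p) f index_set"
    have "L2_has_sum (Omega l) (\<lambda>t p. A t * (up p * psi \<beta> l t p)) (\<lambda>p. up p * f p) index_set"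
      using f smooth_imp_L2[OF psi_smooth] up up_bound _ A[THEN conjunct2]
      by (rule L2_has_sum_mult_bounded) simp_all
    then have "L2_has_sum (Omega l) (\<lambda>t p. A t * trig_basis l t p) h index_set"
      by (simp add: psi h_def[abs_def] up_down)
    from L2_has_sum_orthonormal_coefficient[OF h trig_basis_L2 trig_basis_orthonormal[OF \<open>l > 0\<close>] this]
    show "A = restrict (\<lambda>t. L2_inner (Omega l) h (trig_basis l t)) index_set"
      using A by (auto simp: fun_eq_iff PiE_def extensional_def)
  qed
qed

lemma psi_not_AE_0:
  assumes "l > 0" "t \<in> index_set"
  shows "\<not> (AE p in lebesgue_on (Omega l). psi \<beta> l t p = 0)"
proof
  assume "AE p in lebesgue_on (Omega l). psi \<beta> l t p = 0"
  then have "AE p in lebesgue_on (Omega l). trig_basis l t p = 0"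
    by (simp add: psi_eq_trig_basis)
  then have "L2_norm (Omega l) (trig_basis l t) = 0"
    using L2_norm_eq_0_iff[OF trig_basis_L2] by blast
  then show False
    using trig_basis_orthonormal[OF assms(1,2,2)] L2_norm_power2[of "Omega l" "trig_basis l t"] by simp
qed

theorem theorem2p1:
  fixes \<beta> l :: real
  assumes "\<beta> > 0" and "l > 0"
  shows "(\<forall>(i, m, n)\<in>index_set. vorticity_eigenfunction \<beta> l (mu \<beta> l m n) (psi \<beta> l (i, m, n)))
    \<and> complete_basis (Omega l) (psi \<beta> l) index_set
    \<and> (\<forall>(i, m, n)\<in>index_set. \<forall>(j, k, h)\<in>index_set.
        integrable (lebesgue_on (Omega l))
          (\<lambda>p. psi \<beta> l (i, m, n) p * exp (\<beta> * snd p) * psi \<beta> l (j, k, h) p)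
        \<and> weighted_inner \<beta> l (psi \<beta> l (i, m, n)) (psi \<beta> l (j, k, h))
          = of_bool (i = j) * of_bool (m = k) * of_bool (n = h))"
proof (intro conjI)
  show "\<forall>(i, m, n)\<in>index_set. vorticity_eigenfunction \<beta> l (mu \<beta> l m n) (psi \<beta> l (i, m, n))"
    using psi_sobolev0[OF \<open>l > 0\<close>] psi_not_AE_0[OF \<open>l > 0\<close>] psi_vorticity[OF \<open>l > 0\<close>]
    by (auto simp: vorticity_eigenfunction_def)
  show "complete_basis (Omega l) (psi \<beta> l) index_set"
    using assms by (rule psi_complete_basis)
  have "integrable (lebesgue_on (Omega l)) (\<lambda>p. psi \<beta> l s p * exp (\<beta> * snd p) * psi \<beta> l t p)
    \<and> weighted_inner \<beta> l (psi \<beta> l s) (psi \<beta> l t) = of_bool (s = t)"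
    if "s \<in> index_set" "t \<in> index_set" for s t
    unfolding weighted_inner_def psi_weighted_product
    using L2_mult_integrable[OF trig_basis_L2 trig_basis_L2] trig_basis_orthonormal[OF \<open>l > 0\<close> that]
    by (simp add: L2_inner_def)
  then show "\<forall>(i, m, n)\<in>index_set. \<forall>(j, k, h)\<in>index_set.
        integrable (lebesgue_on (Omega l))
          (\<lambda>p. psi \<beta> l (i, m, n) p * exp (\<beta> * snd p) * psi \<beta> l (j, k, h) p)
        \<and> weighted_inner \<beta> l (psi \<beta> l (i, m, n)) (psi \<beta> l (j, k, h))
          = of_bool (i = j) * of_bool (m = k) * of_bool (n = h)"
    by fastforce
qed

end
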